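(* Let $K$ be a field and let $n\in\{0,1,2,\dots\}$. There exists an indecomposable representation $M:(\mathbb{Z}\times\mathbb{Z},\le)\to\mathrm{vect}_K$ with finite support whose support has exactly $n$ holes.
   Context: $\mathrm{vect}_K$ is the category of finite-dimensional $K$-vector spaces. $\mathbb{Z}\times\mathbb{Z}$ carries the product order: $(a,b)\le(x,y)$ iff $a\le x$ and $b\le y$. A 2D persistence module is a functor $M:(\mathbb{Z}\times\mathbb{Z},\le)\to\mathrm{vect}_K$; direct sums are taken pointwise. $M$ is indecomposable if $M\ne0$ and $M\cong W\oplus W'$ implies $W=0$ or $W'=0$. Its support is $\mathrm{supp}(M)=\{x: M(x)\neq0\}$. The clique cubical complex of $\mathrm{supp}(M)$ is the cubical complex whose vertices are the points of $\mathrm{supp}(M)$, with an edge between any two points of $\mathrm{supp}(M)$ that are adjacent on the grid $\mathbb{Z}^2$ (differ by $1$ in exactly one coordinate), and with a unit square for each $(i,j)$ such that $(i,j),(i,j+1),(i+1,j+1),(i+1,j)\in\mathrm{supp}(M)$. The support of $M$ has exactly $n$ holes if the $1$-dimensional homology (with coefficients in $K$) of this complex has dimension $n$. *)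

theory Defs
  imports
    "HOL-Analysis.Product_Vector"
    "HOL-Library.Product_Order"
    "HOL-Library.Poly_Mapping"
begin

section \<open>Two-dimensional persistence modules\<close>

definition linear_on ::
  "('k::field \<Rightarrow> 'v::ab_group_add \<Rightarrow> 'v) \<Rightarrow> ('k \<Rightarrow> 'w::ab_group_add \<Rightarrow> 'w) \<Rightarrow>
   'v set \<Rightarrow> 'w set \<Rightarrow> ('v \<Rightarrow> 'w) \<Rightarrow> bool" where
  "linear_on s t V W f \<longleftrightarrow>
     f ` V \<subseteq> W \<and>
     (\<forall>u\<in>V. \<forall>v\<in>V. f (u + v) = f u + f v) \<and>
     (\<forall>c. \<forall>v\<in>V. f (s c v) = t c (f v))"

text \<open>
  The vector spaces of a persistence module are subspaces of one ambient vector space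
  \<open>'v\<close>.  The order on \<open>int \<times> int\<close> is the product order.  Only the maps
  \<open>Tr M x y\<close> with \<open>x \<le> y\<close>, restricted to \<open>Sp M x\<close>, are meaningful; their values elsewhere
  are irrelevant to all notions below.
\<close>

record 'v pmodule =
  Sp :: "int \<times> int \<Rightarrow> 'v set"
  Tr :: "int \<times> int \<Rightarrow> int \<times> int \<Rightarrow> 'v \<Rightarrow> 'v"

locale persistence_module = vector_space scale
  for scale :: "'k::field \<Rightarrow> 'v::ab_group_add \<Rightarrow> 'v" +
  fixes M :: "'v pmodule"
  assumes fin_dim: "\<exists>B. finite B \<and> Sp M x = span B"
    and lin: "x \<le> y \<Longrightarrow> linear_on scale scale (Sp M x) (Sp M y) (Tr M x y)"
    and ident: "v \<in> Sp M x \<Longrightarrow> Tr M x x v = v"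
    and comp: "x \<le> y \<Longrightarrow> y \<le> z \<Longrightarrow> v \<in> Sp M x \<Longrightarrow> Tr M y z (Tr M x y v) = Tr M x z v"

definition zero_pmodule :: "'v::zero pmodule \<Rightarrow> bool" where
  "zero_pmodule M \<longleftrightarrow> (\<forall>x. Sp M x = {0})"

definition supp :: "'v::zero pmodule \<Rightarrow> (int \<times> int) set" where
  "supp M = {x. Sp M x \<noteq> {0}}"

definition direct_sum :: "'v pmodule \<Rightarrow> 'w pmodule \<Rightarrow> ('v \<times> 'w) pmodule" where
  "direct_sum W W' =
     \<lparr>Sp = \<lambda>x. Sp W x \<times> Sp W' x, Tr = \<lambda>x y. map_prod (Tr W x y) (Tr W' x y)\<rparr>"

definition isomorphism ::
  "('k::field \<Rightarrow> 'v::ab_group_add \<Rightarrow> 'v) \<Rightarrow> ('k \<Rightarrow> 'w::ab_group_add \<Rightarrow> 'w) \<Rightarrow>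
   'v pmodule \<Rightarrow> 'w pmodule \<Rightarrow> (int \<times> int \<Rightarrow> 'v \<Rightarrow> 'w) \<Rightarrow> bool" where
  "isomorphism s t M N \<phi> \<longleftrightarrow>
     (\<forall>x. linear_on s t (Sp M x) (Sp N x) (\<phi> x) \<and> bij_betw (\<phi> x) (Sp M x) (Sp N x)) \<and>
     (\<forall>x y. x \<le> y \<longrightarrow> (\<forall>v\<in>Sp M x. \<phi> y (Tr M x y v) = Tr N x y (\<phi> x v)))"

definition isomorphic ::
  "('k::field \<Rightarrow> 'v::ab_group_add \<Rightarrow> 'v) \<Rightarrow> ('k \<Rightarrow> 'w::ab_group_add \<Rightarrow> 'w) \<Rightarrow>
   'v pmodule \<Rightarrow> 'w pmodule \<Rightarrow> bool" where
  "isomorphic s t M N \<longleftrightarrow> (\<exists>\<phi>. isomorphism s t M N \<phi>)"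

text \<open>
  The summands range over persistence modules in the same ambient space as \<open>M\<close>.  This is no
  restriction, since every summand of \<open>M\<close> is isomorphic to a submodule of \<open>M\<close>: see lemma
  \<open>indecomposable_any_ambient\<close> below.  The external direct sum \<open>direct_sum W W'\<close> lives in
  the product space, with scalar multiplication \<open>module_prod.scale s s\<close>.
\<close>

definition indecomposable :: "('k::field \<Rightarrow> 'v::ab_group_add \<Rightarrow> 'v) \<Rightarrow> 'v pmodule \<Rightarrow> bool" where
  "indecomposable s M \<longleftrightarrow>
     \<not> zero_pmodule M \<and>
     (\<forall>W W'. persistence_module s W \<longrightarrow> persistence_module s W' \<longrightarrow>
        isomorphic s (module_prod.scale s s) M (direct_sum W W') \<longrightarrow>
        zero_pmodule W \<or> zero_pmodule W')"

context persistence_module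
begin

lemma subspace_Sp: "subspace (Sp M x)"
  using fin_dim[of x] subspace_span by auto

lemma restrict:
  assumes A: "\<And>x. subspace (A x)" "\<And>x. A x \<subseteq> Sp M x"
    and cl: "\<And>x y v. x \<le> y \<Longrightarrow> v \<in> A x \<Longrightarrow> Tr M x y v \<in> A y"
  shows "persistence_module scale \<lparr>Sp = A, Tr = Tr M\<rparr>"
proof unfold_locales
  fix x
  obtain B where B: "finite B" "Sp M x = span B" using fin_dim by blast
  obtain C where C: "C \<subseteq> A x" "independent C" "A x \<subseteq> span C"
    using basis_exists by metis
  have "finite C" using independent_span_bound[OF B(1) C(2)] B(2) C(1) A(2)[of x] by blast
  moreover have "span C = A x" using C A(1) by (meson span_minimal subset_antisym)
  ultimately show "\<exists>B. finite B \<and> Sp \<lparr>Sp = A, Tr = Tr M\<rparr> x = span B" by auto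
next
  fix x y :: "int \<times> int" assume "x \<le> y"
  then show "linear_on scale scale (Sp \<lparr>Sp = A, Tr = Tr M\<rparr> x) (Sp \<lparr>Sp = A, Tr = Tr M\<rparr> y)
      (Tr \<lparr>Sp = A, Tr = Tr M\<rparr> x y)"
    using lin[of x y] cl[of x y] A(2)[of x] unfolding linear_on_def
    by (simp add: image_subset_iff) blast
qed (use A(2) ident comp in \<open>auto simp: subset_iff\<close>)

end

lemma indecomposable_any_ambient:
  fixes s :: "'k::field \<Rightarrow> 'v::ab_group_add \<Rightarrow> 'v"
    and t :: "'k \<Rightarrow> 'w::ab_group_add \<Rightarrow> 'w" and t' :: "'k \<Rightarrow> 'u::ab_group_add \<Rightarrow> 'u"
  assumes M: "persistence_module s M" and ind: "indecomposable s M"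
    and W: "persistence_module t W" and W': "persistence_module t' W'"
    and iso: "isomorphic s (module_prod.scale t t') M (direct_sum W W')"
  shows "zero_pmodule W \<or> zero_pmodule W'"
proof -
  interpret M: persistence_module s M by fact
  interpret W: persistence_module t W by fact
  interpret W': persistence_module t' W' by fact
  interpret P: vector_space_prod t t' by unfold_locales
  interpret Q: vector_space_prod s s by unfold_locales
  obtain \<phi> where lin\<phi>: "\<And>x. linear_on s P.scale (Sp M x) (Sp W x \<times> Sp W' x) (\<phi> x)"
    and bij\<phi>: "\<And>x. bij_betw (\<phi> x) (Sp M x) (Sp W x \<times> Sp W' x)"
    and nat\<phi>: "\<And>x y v. x \<le> y \<Longrightarrow> v \<in> Sp M x \<Longrightarrow>
        \<phi> y (Tr M x y v) = map_prod (Tr W x y) (Tr W' x y) (\<phi> x v)"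
    using iso unfolding isomorphic_def isomorphism_def direct_sum_def pmodule.simps by metis
  have add: "\<phi> x (u + v) = \<phi> x u + \<phi> x v" if "u \<in> Sp M x" "v \<in> Sp M x" for x u v
    using lin\<phi>[of x] that unfolding linear_on_def by blast
  have scl: "\<phi> x (s c v) = P.scale c (\<phi> x v)" if "v \<in> Sp M x" for x c v
    using lin\<phi>[of x] that unfolding linear_on_def by blast
  have mem: "fst (\<phi> x v) \<in> Sp W x" "snd (\<phi> x v) \<in> Sp W' x" if "v \<in> Sp M x" for x v
    using bij_betwE[OF bij\<phi>[of x]] that by (auto simp: mem_Times_iff)
  have inj: "u = v" if "\<phi> x u = \<phi> x v" "u \<in> Sp M x" "v \<in> Sp M x" for x u v
    using bij\<phi>[of x] that unfolding bij_betw_def inj_on_def by blast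
  have surj: "\<exists>v\<in>Sp M x. \<phi> x v = p" if "p \<in> Sp W x \<times> Sp W' x" for x p
    using bij\<phi>[of x] that unfolding bij_betw_def by (metis imageE)
  have z: "\<phi> x 0 = 0" for x
    using add[of 0 x 0] M.subspace_0[OF M.subspace_Sp] by simp
  have W0: "Tr W x y 0 = 0" if "x \<le> y" for x y
    using W.lin[OF that] W.subspace_0[OF W.subspace_Sp[of x]] unfolding linear_on_def
    by (metis add_cancel_right_left add.right_neutral)
  have W'0: "Tr W' x y 0 = 0" if "x \<le> y" for x y
    using W'.lin[OF that] W'.subspace_0[OF W'.subspace_Sp[of x]] unfolding linear_on_def
    by (metis add_cancel_right_left add.right_neutral)
  have Tr: "Tr M x y v \<in> Sp M y" if "x \<le> y" "v \<in> Sp M x" for x y v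
    using M.lin[OF that(1)] that(2) unfolding linear_on_def by blast
  define A where "A x = {v \<in> Sp M x. snd (\<phi> x v) = 0}" for x
  define A' where "A' x = {v \<in> Sp M x. fst (\<phi> x v) = 0}" for x
  have sA: "M.subspace (A x)" for x
    unfolding A_def M.subspace_def using M.subspace_Sp[of x]
    by (auto simp: add scl z P.scale_def M.subspace_0 M.subspace_add M.subspace_scale)
  have sA': "M.subspace (A' x)" for x
    unfolding A'_def M.subspace_def using M.subspace_Sp[of x]
    by (auto simp: add scl z P.scale_def M.subspace_0 M.subspace_add M.subspace_scale)
  have pA: "persistence_module s \<lparr>Sp = A, Tr = Tr M\<rparr>"
    by (rule M.restrict[OF sA]) (auto simp: A_def Tr nat\<phi> W'0)
  have pA': "persistence_module s \<lparr>Sp = A', Tr = Tr M\<rparr>"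
    by (rule M.restrict[OF sA']) (auto simp: A'_def Tr nat\<phi> W0)
  define \<psi> where "\<psi> x p = (THE v. v \<in> Sp M x \<and> \<phi> x v = p)" for x p
  have \<psi>: "\<psi> x p \<in> Sp M x \<and> \<phi> x (\<psi> x p) = p" if "p \<in> Sp W x \<times> Sp W' x" for x p
    unfolding \<psi>_def by (rule theI') (use surj[OF that] inj in blast)
  have \<psi>I: "\<psi> x p = v" if "v \<in> Sp M x" "\<phi> x v = p" for x p v
    unfolding \<psi>_def by (rule the_equality) (use that inj in blast)+
  have W00: "0 \<in> Sp W x" "0 \<in> Sp W' x" for x
    using W.subspace_0[OF W.subspace_Sp] W'.subspace_0[OF W'.subspace_Sp] by auto
  define \<theta> where "\<theta> x v = (\<psi> x (fst (\<phi> x v), 0), \<psi> x (0, snd (\<phi> x v)))" for x v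
  have \<theta>A: "\<psi> x (fst (\<phi> x v), 0) \<in> A x" "\<psi> x (0, snd (\<phi> x v)) \<in> A' x"
    if "v \<in> Sp M x" for x v
    using \<psi>[of "(fst (\<phi> x v), 0)" x] \<psi>[of "(0, snd (\<phi> x v))" x] mem[OF that] W00[of x]
    by (auto simp: A_def A'_def)
  have \<phi>1: "\<phi> x (\<psi> x (fst (\<phi> x v), 0)) = (fst (\<phi> x v), 0)"
    and \<phi>2: "\<phi> x (\<psi> x (0, snd (\<phi> x v))) = (0, snd (\<phi> x v))" if "v \<in> Sp M x" for x v
    using \<psi>[of "(fst (\<phi> x v), 0)" x] \<psi>[of "(0, snd (\<phi> x v))" x] mem[OF that] W00[of x] by auto
  have A: "A x \<subseteq> Sp M x" "A' x \<subseteq> Sp M x" for x by (auto simp: A_def A'_def)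
  have \<theta>m: "\<psi> x (fst (\<phi> x v), 0) \<in> Sp M x" "\<psi> x (0, snd (\<phi> x v)) \<in> Sp M x"
    if "v \<in> Sp M x" for x v using \<theta>A[OF that] A by blast+
  have l1: "linear_on s Q.scale (Sp M x) (A x \<times> A' x) (\<theta> x)" for x
    unfolding linear_on_def
  proof (intro conjI ballI allI)
    show "\<theta> x ` Sp M x \<subseteq> A x \<times> A' x" using \<theta>A[of _ x] by (auto simp: \<theta>_def)
  next
    fix u v assume uv: "u \<in> Sp M x" "v \<in> Sp M x"
    show "\<theta> x (u + v) = \<theta> x u + \<theta> x v"
      unfolding \<theta>_def using uv \<theta>m[OF uv(1)] \<theta>m[OF uv(2)] M.subspace_add[OF M.subspace_Sp[of x]]
      by (auto intro!: \<psi>I simp: add \<phi>1 \<phi>2)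
  next
    fix c v assume v: "v \<in> Sp M x"
    show "\<theta> x (s c v) = Q.scale c (\<theta> x v)"
      unfolding \<theta>_def Q.scale_prod using v \<theta>m[OF v] M.subspace_scale[OF M.subspace_Sp[of x]]
      by (auto intro!: \<psi>I simp: scl \<phi>1 \<phi>2 P.scale_def)
  qed
  have l2: "bij_betw (\<theta> x) (Sp M x) (A x \<times> A' x)" for x
    unfolding bij_betw_def
  proof
    show "inj_on (\<theta> x) (Sp M x)"
    proof (rule inj_onI)
      fix u v assume uv: "u \<in> Sp M x" "v \<in> Sp M x" and eq: "\<theta> x u = \<theta> x v"
      have "\<psi> x (fst (\<phi> x u), 0) = \<psi> x (fst (\<phi> x v), 0)"
        "\<psi> x (0, snd (\<phi> x u)) = \<psi> x (0, snd (\<phi> x v))"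
        using eq unfolding \<theta>_def by (simp_all only: prod.inject)
      then have "fst (\<phi> x u) = fst (\<phi> x v)" "snd (\<phi> x u) = snd (\<phi> x v)"
        using \<phi>1[OF uv(1)] \<phi>1[OF uv(2)] \<phi>2[OF uv(1)] \<phi>2[OF uv(2)]
        by (metis prod.inject)+
      then have "\<phi> x u = \<phi> x v" by (rule prod_eqI)
      then show "u = v" using inj uv by blast
    qed
  next
    have "\<exists>v\<in>Sp M x. \<theta> x v = (a, b)" if ab: "a \<in> A x" "b \<in> A' x" for a b
    proof
      have m: "a \<in> Sp M x" "b \<in> Sp M x" and k: "snd (\<phi> x a) = 0" "fst (\<phi> x b) = 0"
        using ab unfolding A_def A'_def by blast+
      show "a + b \<in> Sp M x" using m M.subspace_add[OF M.subspace_Sp[of x]] by blast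
      have "\<psi> x (fst (\<phi> x (a + b)), 0) = a" "\<psi> x (0, snd (\<phi> x (a + b))) = b"
        by (rule \<psi>I; simp add: m k add prod_eq_iff)+
      then show "\<theta> x (a + b) = (a, b)" by (simp add: \<theta>_def)
    qed
    moreover have "\<theta> x ` Sp M x \<subseteq> A x \<times> A' x"
      using l1[of x] unfolding linear_on_def by blast
    ultimately show "\<theta> x ` Sp M x = A x \<times> A' x"
      by (intro subset_antisym subsetI; simp add: subset_iff image_iff; metis prod.collapse mem_Times_iff)
  qed
  have "isomorphism s Q.scale M (direct_sum \<lparr>Sp = A, Tr = Tr M\<rparr> \<lparr>Sp = A', Tr = Tr M\<rparr>) \<theta>"
    unfolding isomorphism_def
  proof (intro conjI allI impI ballI)
    fix x y v assume xy: "x \<le> y" and v: "v \<in> Sp M x"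
    show "\<theta> y (Tr M x y v) =
        Tr (direct_sum \<lparr>Sp = A, Tr = Tr M\<rparr> \<lparr>Sp = A', Tr = Tr M\<rparr>) x y (\<theta> x v)"
      unfolding direct_sum_def \<theta>_def using \<theta>m[OF v] Tr[OF xy] v
      by (auto intro!: \<psi>I simp: nat\<phi>[OF xy] \<phi>1 \<phi>2 W0[OF xy] W'0[OF xy])
  qed (use l1 l2 in \<open>auto simp: direct_sum_def\<close>)
  then have "zero_pmodule \<lparr>Sp = A, Tr = Tr M\<rparr> \<or> zero_pmodule \<lparr>Sp = A', Tr = Tr M\<rparr>"
    using ind pA pA' unfolding indecomposable_def isomorphic_def by blast
  then show ?thesis
  proof
    assume "zero_pmodule \<lparr>Sp = A, Tr = Tr M\<rparr>"
    then have A0: "A x = {0}" for x unfolding zero_pmodule_def pmodule.simps by blast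
    have "w = 0" if "w \<in> Sp W x" for w x
    proof -
      have "\<psi> x (w, 0) \<in> A x" using \<psi>[of "(w, 0)" x] that W00[of x] by (auto simp: A_def)
      then show ?thesis using \<psi>[of "(w, 0)" x] that W00[of x] A0[of x] z[of x] by (auto simp: zero_prod_def)
    qed
    then show ?thesis using W00 unfolding zero_pmodule_def by blast
  next
    assume "zero_pmodule \<lparr>Sp = A', Tr = Tr M\<rparr>"
    then have A0: "A' x = {0}" for x unfolding zero_pmodule_def pmodule.simps by blast
    have "w = 0" if "w \<in> Sp W' x" for w x
    proof -
      have "\<psi> x (0, w) \<in> A' x" using \<psi>[of "(0, w)" x] that W00[of x] by (auto simp: A'_def)
      then show ?thesis using \<psi>[of "(0, w)" x] that W00[of x] A0[of x] z[of x] by (auto simp: zero_prod_def)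
    qed
    then show ?thesis using W00 unfolding zero_pmodule_def by blast
  qed
qed


section \<open>Free vector spaces\<close>

definition free_scale :: "'k::field \<Rightarrow> ('b \<Rightarrow>\<^sub>0 'k) \<Rightarrow> ('b \<Rightarrow>\<^sub>0 'k)" where
  "free_scale c f = Poly_Mapping.map ((*) c) f"

lemma lookup_free_scale [simp]: "Poly_Mapping.lookup (free_scale c f) b = c * Poly_Mapping.lookup f b"
  unfolding free_scale_def by transfer (simp add: when_def)

interpretation free: vector_space "free_scale :: 'k::field \<Rightarrow> ('b \<Rightarrow>\<^sub>0 'k) \<Rightarrow> _"
  by unfold_locales (auto intro!: poly_mapping_eqI simp: lookup_add algebra_simps)

definition linear_ext :: "('b \<Rightarrow> ('c \<Rightarrow>\<^sub>0 'k::field)) \<Rightarrow> ('b \<Rightarrow>\<^sub>0 'k) \<Rightarrow> ('c \<Rightarrow>\<^sub>0 'k)" where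
  "linear_ext g f = (\<Sum>b\<in>Poly_Mapping.keys f. free_scale (Poly_Mapping.lookup f b) (g b))"


section \<open>Clique cubical complexes in the grid and their holes\<close>

text \<open>
  An edge is given by its pair of end points, the smaller one first, and a unit square by its
  lower left corner.
\<close>

definition edges :: "(int \<times> int) set \<Rightarrow> ((int \<times> int) \<times> (int \<times> int)) set" where
  "edges S = {(p, q). p \<in> S \<and> q \<in> S \<and> (q = p + (1, 0) \<or> q = p + (0, 1))}"

definition squares :: "(int \<times> int) set \<Rightarrow> (int \<times> int) set" where
  "squares S = {(i, j). (i, j) \<in> S \<and> (i, j + 1) \<in> S \<and> (i + 1, j + 1) \<in> S \<and> (i + 1, j) \<in> S}"

definition bdry1 ::
  "((int \<times> int) \<times> (int \<times> int) \<Rightarrow>\<^sub>0 'k::field) \<Rightarrow> (int \<times> int \<Rightarrow>\<^sub>0 'k)" where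
  "bdry1 = linear_ext (\<lambda>(p, q). Poly_Mapping.single q 1 - Poly_Mapping.single p 1)"

text \<open>The boundary of a square traverses its four edges counterclockwise.\<close>

definition bdry2 ::
  "(int \<times> int \<Rightarrow>\<^sub>0 'k::field) \<Rightarrow> ((int \<times> int) \<times> (int \<times> int) \<Rightarrow>\<^sub>0 'k)" where
  "bdry2 = linear_ext (\<lambda>(i, j).
       Poly_Mapping.single ((i, j), (i + 1, j)) 1
     + Poly_Mapping.single ((i + 1, j), (i + 1, j + 1)) 1
     - Poly_Mapping.single ((i, j + 1), (i + 1, j + 1)) 1
     - Poly_Mapping.single ((i, j), (i, j + 1)) 1)"

definition cycles1 :: "(int \<times> int) set \<Rightarrow> ((int \<times> int) \<times> (int \<times> int) \<Rightarrow>\<^sub>0 'k::field) set" where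
  "cycles1 S = {f. Poly_Mapping.keys f \<subseteq> edges S \<and> bdry1 f = 0}"

definition boundaries1 :: "(int \<times> int) set \<Rightarrow> ((int \<times> int) \<times> (int \<times> int) \<Rightarrow>\<^sub>0 'k::field) set" where
  "boundaries1 S = bdry2 ` {g. Poly_Mapping.keys g \<subseteq> squares S}"

text \<open>
  For subspaces \<open>B \<subseteq> Z\<close>, \<open>quotient_has_dim s Z B n\<close> says that the quotient space \<open>Z / B\<close> has
  dimension \<open>n\<close>: it has a basis of \<open>n\<close> elements, namely the classes of the elements of \<open>C\<close>
  (which are pairwise distinct by the linear independence modulo \<open>B\<close>).
\<close>

definition quotient_has_dim ::
  "('k::field \<Rightarrow> 'v::ab_group_add \<Rightarrow> 'v) \<Rightarrow> 'v set \<Rightarrow> 'v set \<Rightarrow> nat \<Rightarrow> bool" where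
  "quotient_has_dim s Z B n \<longleftrightarrow>
     (\<exists>C. finite C \<and> card C = n \<and> C \<subseteq> Z \<and>
        (\<forall>z\<in>Z. \<exists>u. z - (\<Sum>c\<in>C. s (u c) c) \<in> B) \<and>
        (\<forall>u. (\<Sum>c\<in>C. s (u c) c) \<in> B \<longrightarrow> (\<forall>c\<in>C. u c = 0)))"

definition has_holes :: "'k::field itself \<Rightarrow> (int \<times> int) set \<Rightarrow> nat \<Rightarrow> bool" where
  "has_holes _ S n \<longleftrightarrow>
     quotient_has_dim free_scale
       (cycles1 S :: ((int \<times> int) \<times> (int \<times> int) \<Rightarrow>\<^sub>0 'k) set) (boundaries1 S) n"

lemma linear_ext_superset:
  assumes "finite K" "Poly_Mapping.keys f \<subseteq> K"
  shows "linear_ext g f = (\<Sum>b\<in>K. free_scale (Poly_Mapping.lookup f b) (g b))"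
  unfolding linear_ext_def
  by (rule sum.mono_neutral_left) (use assms in \<open>auto simp: in_keys_iff\<close>)

lemma linear_ext_add: "linear_ext g (f + f') = linear_ext g f + linear_ext g f'"
proof -
  let ?K = "Poly_Mapping.keys f \<union> Poly_Mapping.keys f'"
  have "Poly_Mapping.keys (f + f') \<subseteq> ?K" by (rule Poly_Mapping.keys_add)
  then show ?thesis
    by (simp add: linear_ext_superset[of ?K] lookup_add free.scale_left_distrib sum.distrib)
qed

lemma linear_ext_scale: "linear_ext g (free_scale c f) = free_scale c (linear_ext g f)"
proof -
  have "Poly_Mapping.keys (free_scale c f) \<subseteq> Poly_Mapping.keys f" by (auto simp: in_keys_iff)
  then show ?thesis
    by (simp add: linear_ext_superset[of "Poly_Mapping.keys f"] free.scale_sum_right)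
qed

lemma linear_ext_linear: "Vector_Spaces.linear free_scale free_scale (linear_ext g)"
  by unfold_locales (simp_all add: linear_ext_add linear_ext_scale)

lemma linear_ext_single [simp]: "linear_ext g (Poly_Mapping.single b 1) = g b"
  by (simp add: linear_ext_def)

lemma bdry1_bdry2: "bdry1 (bdry2 g) = 0"
proof -
  interpret d: Vector_Spaces.linear free_scale free_scale
    "bdry1 :: ((int \<times> int) \<times> (int \<times> int) \<Rightarrow>\<^sub>0 'a) \<Rightarrow> _"
    unfolding bdry1_def by (rule linear_ext_linear)
  have single: "bdry1 (Poly_Mapping.single (p, q) (1::'a)) =
      Poly_Mapping.single q 1 - Poly_Mapping.single p 1" for p q :: "int \<times> int"
    by (simp add: bdry1_def)
  show ?thesis
    unfolding bdry2_def linear_ext_def[of _ g]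
    by (auto simp: d.sum d.scale d.add d.diff single intro!: sum.neutral)
qed

lemma boundaries1_subset_cycles1: "boundaries1 S \<subseteq> cycles1 S"
proof -
  have "Poly_Mapping.keys (bdry2 g) \<subseteq> edges S" if g: "Poly_Mapping.keys g \<subseteq> squares S" for g :: "_ \<Rightarrow>\<^sub>0 'a"
  proof
    fix e assume "e \<in> Poly_Mapping.keys (bdry2 g)"
    then have "(\<Sum>b\<in>Poly_Mapping.keys g. Poly_Mapping.lookup g b * Poly_Mapping.lookup (case b of (i, j) \<Rightarrow>
       Poly_Mapping.single ((i, j), (i + 1, j)) 1
     + Poly_Mapping.single ((i + 1, j), (i + 1, j + 1)) 1
     - Poly_Mapping.single ((i, j + 1), (i + 1, j + 1)) 1
     - Poly_Mapping.single ((i, j), (i, j + 1)) 1) e) \<noteq> 0"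
      by (simp add: in_keys_iff bdry2_def linear_ext_def lookup_sum)
    then obtain i j where ij: "(i, j) \<in> Poly_Mapping.keys g" and
      "Poly_Mapping.lookup (Poly_Mapping.single ((i, j), (i + 1, j)) 1
     + Poly_Mapping.single ((i + 1, j), (i + 1, j + 1)) 1
     - Poly_Mapping.single ((i, j + 1), (i + 1, j + 1)) 1
     - Poly_Mapping.single ((i, j), (i, j + 1)) (1::'a)) e \<noteq> 0"
      by (auto elim!: sum.not_neutral_contains_not_neutral)
    then have "e \<in> {((i, j), (i + 1, j)), ((i + 1, j), (i + 1, j + 1)),
        ((i, j + 1), (i + 1, j + 1)), ((i, j), (i, j + 1))}"
      by (auto simp: lookup_add lookup_minus lookup_single when_def split: if_splits)
    moreover have "(i, j) \<in> squares S" using ij g by blast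
    ultimately show "e \<in> edges S" by (auto simp: edges_def squares_def)
  qed
  then show ?thesis by (auto simp: boundaries1_def cycles1_def bdry1_bdry2)
qed

end

theory Submission
  imports Defs
begin

text \<open>
  Two staircases run side by side in the direction (1, -1), meeting in the points (2i, -2i).  Their
  union is a chain of \<open>n\<close> rings of eight points, consecutive rings sharing a corner, so it has \<open>n\<close>
  holes.  The direct sum of the two interval modules supported on the staircases decomposes.  To tie
  the summands together, both staircases are extended by a point \<open>t = (-1, 0)\<close> below the first
  corner, and the sum is replaced by its submodule whose space at \<open>t\<close> is only the diagonal.
  An idempotent endomorphism acts on the lower interval module by a scalar, on the upper one by a scalar
  modulo the lower one, and the diagonal forces the two scalars to agree.  The homomorphisms from the
  upper to the lower interval module do not disturb this comparison, because the lower staircase also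
  contains the points (-1, 1) and (0, 1), through which \<open>t\<close> reaches it without meeting the upper one.
  These points add one filled square to the support, hence no hole.
\<close>

section \<open>Indecomposability through idempotent endomorphisms\<close>

text \<open>A decomposition of \<open>M\<close> into \<open>W\<close> and \<open>W'\<close> turns
  the projection onto \<open>W\<close> into an idempotent endomorphism of \<open>M\<close>. If that
  is zero then \<open>W\<close> vanishes, and if it is the identity then \<open>W'\<close>
  vanishes.\<close>

lemma (in persistence_module) indecomposableI:
  assumes nz: "\<not> zero_pmodule M"
    and idem: "\<And>e. (\<And>x. linear_on scale scale (Sp M x) (Sp M x) (e x)) \<Longrightarrow>
      (\<And>x v. v \<in> Sp M x \<Longrightarrow> e x (e x v) = e x v) \<Longrightarrow>
      (\<And>x y v. x \<le> y \<Longrightarrow> v \<in> Sp M x \<Longrightarrow> e y (Tr M x y v) = Tr M x y (e x v)) \<Longrightarrow>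
      (\<forall>x. \<forall>v\<in>Sp M x. e x v = 0) \<or> (\<forall>x. \<forall>v\<in>Sp M x. e x v = v)"
  shows "indecomposable scale M"
  unfolding indecomposable_def
proof (intro conjI allI impI)
  fix W W' :: "'v pmodule"
  assume pW: "persistence_module scale W" and pW': "persistence_module scale W'"
    and iso: "isomorphic scale (module_prod.scale scale scale) M (direct_sum W W')"
  interpret W: persistence_module scale W by fact
  interpret W': persistence_module scale W' by fact
  interpret P: vector_space_prod scale scale by unfold_locales
  obtain \<phi> where lin\<phi>: "\<And>x. linear_on scale P.scale (Sp M x) (Sp W x \<times> Sp W' x) (\<phi> x)"
    and bij\<phi>: "\<And>x. bij_betw (\<phi> x) (Sp M x) (Sp W x \<times> Sp W' x)"
    and nat\<phi>: "\<And>x y v. x \<le> y \<Longrightarrow> v \<in> Sp M x \<Longrightarrow>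
        \<phi> y (Tr M x y v) = map_prod (Tr W x y) (Tr W' x y) (\<phi> x v)"
    using iso unfolding isomorphic_def isomorphism_def direct_sum_def pmodule.simps by metis
  have add: "\<phi> x (u + v) = \<phi> x u + \<phi> x v" if "u \<in> Sp M x" "v \<in> Sp M x" for x u v
    using lin\<phi>[of x] that unfolding linear_on_def by blast
  have scl: "\<phi> x (scale c v) = P.scale c (\<phi> x v)" if "v \<in> Sp M x" for x c v
    using lin\<phi>[of x] that unfolding linear_on_def by blast
  have mem: "fst (\<phi> x v) \<in> Sp W x" "snd (\<phi> x v) \<in> Sp W' x" if "v \<in> Sp M x" for x v
    using bij_betwE[OF bij\<phi>[of x]] that by (auto simp: mem_Times_iff)
  have inj: "u = v" if "\<phi> x u = \<phi> x v" "u \<in> Sp M x" "v \<in> Sp M x" for x u v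
    using bij\<phi>[of x] that unfolding bij_betw_def inj_on_def by blast
  have W0: "0 \<in> Sp W x" "0 \<in> Sp W' x" for x
    using subspace_0[OF W.subspace_Sp] subspace_0[OF W'.subspace_Sp] by auto
  have Tr0: "Tr W' x y 0 = 0" if "x \<le> y" for x y
    using W'.lin[OF that] W0(2)[of x] unfolding linear_on_def
    by (metis add_cancel_right_left add.right_neutral)
  have Tr: "Tr M x y v \<in> Sp M y" if "x \<le> y" "v \<in> Sp M x" for x y v
    using lin[OF that(1)] that(2) unfolding linear_on_def by blast
  \<comment> \<open>The projection onto \<open>W\<close>, carried back to \<open>M\<close>;
    \<open>\<phi> x\<close> is invertible only as a map on \<open>Sp M x\<close>.\<close>
  define e where "e x v = inv_into (Sp M x) (\<phi> x) (fst (\<phi> x v), 0)" for x v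
  have img: "\<phi> x ` Sp M x = Sp W x \<times> Sp W' x" for x
    using bij\<phi> unfolding bij_betw_def by blast
  have e: "e x v \<in> Sp M x" "\<phi> x (e x v) = (fst (\<phi> x v), 0)" if "v \<in> Sp M x" for x v
    using mem(1)[OF that] W0(2)[of x] unfolding e_def
    by (auto simp: img intro!: inv_into_into f_inv_into_f)
  have addM: "u + v \<in> Sp M x" if "u \<in> Sp M x" "v \<in> Sp M x" for x u v
    using subspace_add[OF subspace_Sp] that .
  have sclM: "scale c v \<in> Sp M x" if "v \<in> Sp M x" for x c v
    using subspace_scale[OF subspace_Sp] that .
  have "(\<forall>x. \<forall>v\<in>Sp M x. e x v = 0) \<or> (\<forall>x. \<forall>v\<in>Sp M x. e x v = v)"
  proof (rule idem)
    \<comment> \<open>Each identity for \<open>e\<close> is checked after applying the injective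
      \<open>\<phi>\<close>, where \<open>e\<close> becomes the map from \<open>(w, w')\<close> to
      \<open>(w, 0)\<close>.\<close>
    show "linear_on scale scale (Sp M x) (Sp M x) (e x)" for x
      unfolding linear_on_def
    proof (intro conjI ballI allI)
      show "e x ` Sp M x \<subseteq> Sp M x" using e by blast
      show "e x (u + v) = e x u + e x v" if "u \<in> Sp M x" "v \<in> Sp M x" for u v
        by (rule inj[of x]) (simp_all add: that add e addM)
      show "e x (scale c v) = scale c (e x v)" if "v \<in> Sp M x" for c v
        by (rule inj[of x]) (simp_all add: that scl e sclM P.scale_def)
    qed
    show "e x (e x v) = e x v" if "v \<in> Sp M x" for x v
      by (rule inj[of x]) (simp_all add: that e)
    show "e y (Tr M x y v) = Tr M x y (e x v)" if "x \<le> y" "v \<in> Sp M x" for x y v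
      by (rule inj[of y]) (simp_all add: that e Tr nat\<phi> Tr0)
  qed
  then show "zero_pmodule W \<or> zero_pmodule W'"
  proof (elim disjE)
    assume z: "\<forall>x. \<forall>v\<in>Sp M x. e x v = 0"
    have "w = 0" if "w \<in> Sp W x" for x w
    proof -
      have "(w, 0) \<in> \<phi> x ` Sp M x" using img that W0 by simp
      then obtain v where v: "v \<in> Sp M x" "\<phi> x v = (w, 0)" by auto
      have "\<phi> x 0 = 0" using add[of 0 x 0] subspace_0[OF subspace_Sp] by simp
      then have "(w, 0) = (0 :: 'v \<times> 'v)" using e(2)[OF v(1)] z v by simp
      then show ?thesis by (simp add: zero_prod_def)
    qed
    then show ?thesis using W0 unfolding zero_pmodule_def by blast
  next
    assume z: "\<forall>x. \<forall>v\<in>Sp M x. e x v = v"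
    have "w = 0" if "w \<in> Sp W' x" for x w
    proof -
      have "(0, w) \<in> \<phi> x ` Sp M x" using img that W0 by simp
      then obtain v where v: "v \<in> Sp M x" "\<phi> x v = (0, w)" by auto
      then show ?thesis using e(2)[OF v(1)] z by simp
    qed
    then show ?thesis using W0 unfolding zero_pmodule_def by blast
  qed
qed (rule nz)

section \<open>Gluing two interval modules at a point\<close>

definition vec2 :: "'k \<Rightarrow> 'k \<Rightarrow> (nat \<Rightarrow>\<^sub>0 'k::field)" where
  "vec2 a b = Poly_Mapping.single 0 a + Poly_Mapping.single 1 b"

lemma lookup_vec2 [simp]:
  "Poly_Mapping.lookup (vec2 a b) 0 = a" "Poly_Mapping.lookup (vec2 a b) (Suc 0) = b"
  by (simp_all add: vec2_def lookup_add lookup_single)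

lemma vec2_eq_iff [simp]: "vec2 a b = vec2 c d \<longleftrightarrow> a = c \<and> b = d"
  by (metis lookup_vec2)

lemma vec2_add [simp]: "vec2 a b + vec2 c d = vec2 (a + c) (b + d)"
  by (simp add: vec2_def single_add)

lemma vec2_scale [simp]: "free_scale c (vec2 a b) = vec2 (c * a) (c * b)"
  by (rule poly_mapping_eqI) (simp add: vec2_def lookup_add lookup_single when_def)

lemma vec2_0: "vec2 0 0 = 0"
  by (simp add: vec2_def)

lemma vec2_eq_0_iff [simp]: "vec2 a b = 0 \<longleftrightarrow> a = 0 \<and> b = 0"
  by (metis vec2_0 vec2_eq_iff)

text \<open>The coordinates 0 and 1 carry the interval modules on \<open>P\<close> and on \<open>Q\<close>.\<close>

definition glued_module ::
  "(int \<times> int) set \<Rightarrow> (int \<times> int) set \<Rightarrow> int \<times> int \<Rightarrow> (nat \<Rightarrow>\<^sub>0 'k::field) pmodule" where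
  "glued_module P Q t =
     \<lparr>Sp = \<lambda>x. {vec2 a b |a b. (a \<noteq> 0 \<longrightarrow> x \<in> P) \<and> (b \<noteq> 0 \<longrightarrow> x \<in> Q) \<and> (x = t \<longrightarrow> a = b)},
      Tr = \<lambda>x y f. vec2 (if y \<in> P then Poly_Mapping.lookup f 0 else 0)
                       (if y \<in> Q then Poly_Mapping.lookup f 1 else 0)\<rparr>"

text \<open>Convexity is one half of the notion of an interval in a poset,
  \<open>zigzag_connected\<close> the other. Convexity makes the transition maps compose;
  connectedness makes an endomorphism act by one scalar.\<close>

definition order_convex :: "'a::order set \<Rightarrow> bool" where
  "order_convex A \<longleftrightarrow> (\<forall>x\<in>A. \<forall>z\<in>A. \<forall>y. x \<le> y \<longrightarrow> y \<le> z \<longrightarrow> y \<in> A)"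

definition comparability :: "'a::order set \<Rightarrow> ('a \<times> 'a) set" where
  "comparability A = {(x, y). x \<in> A \<and> y \<in> A \<and> (x \<le> y \<or> y \<le> x)}"

definition zigzag_connected :: "'a::order set \<Rightarrow> bool" where
  "zigzag_connected A \<longleftrightarrow> (\<forall>x\<in>A. \<forall>y\<in>A. (x, y) \<in> (comparability A)\<^sup>*)"

text \<open>Meant for the scalars by which an endomorphism acts at single points: naturality equates
  them at comparable points.\<close>

lemma zigzag_connected_const:
  assumes "zigzag_connected A" "x \<in> A" "y \<in> A"
    and mono: "\<And>x y. x \<in> A \<Longrightarrow> y \<in> A \<Longrightarrow> x \<le> y \<Longrightarrow> f x = f y"
  shows "f x = f y"
proof -
  have "(x, y) \<in> (comparability A)\<^sup>*" using assms unfolding zigzag_connected_def by blast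
  then show ?thesis
    by (induction rule: rtrancl_induct) (auto simp: comparability_def dest: mono)
qed

lemma zigzag_connectedI:
  assumes "\<And>x. x \<in> A \<Longrightarrow> (x, p) \<in> (comparability A)\<^sup>*"
  shows "zigzag_connected A"
proof -
  have "sym ((comparability A)\<^sup>*)"
    by (intro sym_rtrancl symI) (auto simp: comparability_def)
  then show ?thesis
    unfolding zigzag_connected_def using assms by (meson rtrancl_trans symD)
qed

lemma supp_glued_module:
  assumes "t \<in> P" "t \<in> Q"
  shows "supp (glued_module P Q t :: (nat \<Rightarrow>\<^sub>0 'k::field) pmodule) = P \<union> Q"
proof -
  have "x \<in> P \<union> Q \<longleftrightarrow> Sp (glued_module P Q t :: (nat \<Rightarrow>\<^sub>0 'k) pmodule) x \<noteq> {0}" for x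
  proof
    assume "x \<in> P \<union> Q"
    \<comment> \<open>A 1 in every available coordinate. At \<open>t\<close> both coordinates are
      available, so this vector lies on the diagonal.\<close>
    then have "vec2 (of_bool (x \<in> P)) (of_bool (x \<in> Q)) \<in> Sp (glued_module P Q t :: (nat \<Rightarrow>\<^sub>0 'k) pmodule) x"
      using assms by (auto simp: glued_module_def)
    then show "Sp (glued_module P Q t :: (nat \<Rightarrow>\<^sub>0 'k) pmodule) x \<noteq> {0}"
      using \<open>x \<in> P \<union> Q\<close> by force
  qed (auto simp: glued_module_def vec2_0)
  then show ?thesis by (auto simp: supp_def)
qed

text \<open>By convexity, a coordinate alive at both ends of a composite is alive in the middle.
  Minimality of \<open>t\<close> prevents a transition map from another point of the support from
  landing off the diagonal at \<open>t\<close>.\<close>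

lemma persistence_module_glued_module:
  assumes t: "t \<in> P" "t \<in> Q" and P: "order_convex P" and Q: "order_convex Q"
    and min: "\<And>x. x \<in> P \<union> Q \<Longrightarrow> x \<le> t \<Longrightarrow> x = t"
  shows "persistence_module free_scale (glued_module P Q t :: (nat \<Rightarrow>\<^sub>0 'k::field) pmodule)"
    (is "persistence_module _ ?M")
proof unfold_locales
  fix x
  have sub: "free.subspace (Sp ?M x)"
    unfolding free.subspace_def
  proof (intro conjI ballI allI)
    show "0 \<in> Sp ?M x" by (auto simp: glued_module_def vec2_0[symmetric] simp del: vec2_eq_0_iff)
  qed (fastforce simp: glued_module_def)+
  obtain C where C: "C \<subseteq> Sp ?M x" "free.independent C" "Sp ?M x \<subseteq> free.span C"
    using free.basis_exists by metis
  have "Sp ?M x \<subseteq> free.span {vec2 1 0, vec2 0 1}"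
  proof
    fix v assume "v \<in> Sp ?M x"
    then obtain a b where "v = free_scale a (vec2 1 0) + free_scale b (vec2 0 1)"
      by (auto simp: glued_module_def)
    then show "v \<in> free.span {vec2 1 0, vec2 0 1}"
      by (simp only:) (intro free.span_add free.span_scale free.span_base; simp)
  qed
  then have "finite C"
    using free.independent_span_bound[of "{vec2 1 0, vec2 0 1}" C] C by blast
  moreover have "Sp ?M x = free.span C" using C sub by (meson free.span_minimal subset_antisym)
  ultimately show "\<exists>B. finite B \<and> Sp ?M x = free.span B" by blast
next
  fix x y :: "int \<times> int" assume xy: "x \<le> y"
  then show "linear_on free_scale free_scale (Sp ?M x) (Sp ?M y) (Tr ?M x y)"
    unfolding linear_on_def
  proof (intro conjI ballI allI)
    show "Tr ?M x y ` Sp ?M x \<subseteq> Sp ?M y"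
    proof
      fix w assume "w \<in> Tr ?M x y ` Sp ?M x"
      then obtain v where v: "w = Tr ?M x y v" "v \<in> Sp ?M x" by blast
      then obtain a b where "v = vec2 a b"
        and ab: "a \<noteq> 0 \<longrightarrow> x \<in> P" "b \<noteq> 0 \<longrightarrow> x \<in> Q" "x = t \<longrightarrow> a = b"
        unfolding glued_module_def by auto
      then have w: "w = vec2 (if y \<in> P then a else 0) (if y \<in> Q then b else 0)"
        using v by (simp add: glued_module_def)
      \<comment> \<open>Either \<open>x = t\<close> and \<open>a = b\<close> already, or
        \<open>x\<close> lies outside both sets by minimality and \<open>a = b = 0\<close>.\<close>
      have "(if y \<in> P then a else 0) = (if y \<in> Q then b else 0)" if "y = t"
        using t min[of x] ab xy that by auto
      then show "w \<in> Sp ?M y" unfolding glued_module_def pmodule.simps w by auto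
    qed
  qed (auto simp: glued_module_def)
next
  fix x y z :: "int \<times> int" and v :: "nat \<Rightarrow>\<^sub>0 'k"
  assume xy: "x \<le> y" "y \<le> z" "v \<in> Sp ?M x"
  have "y \<in> P" if "x \<in> P" "z \<in> P" using P xy that unfolding order_convex_def by blast
  moreover have "y \<in> Q" if "x \<in> Q" "z \<in> Q" using Q xy that unfolding order_convex_def by blast
  ultimately show "Tr ?M y z (Tr ?M x y v) = Tr ?M x z v"
    using xy(3) by (auto simp: glued_module_def)
qed (auto simp: glued_module_def)

text \<open>The aim is that \<open>e\<close> is multiplication by its eigenvalue \<tau> on the
  diagonal at \<open>t\<close>. By \<open>below\<close>, coordinate 0 is stable under
  \<open>e\<close>; \<open>p\<close> and \<open>q\<close> compare \<tau> with the scalars on the two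
  coordinates, and connectedness spreads these scalars. Connectedness is needed away from
  \<open>t\<close>, since the basis vectors \<open>vec2 1 0\<close> and \<open>vec2 0 1\<close> are
  not in the space at \<open>t\<close>.\<close>

lemma indecomposable_glued_module:
  assumes M: "persistence_module free_scale (glued_module P Q t :: (nat \<Rightarrow>\<^sub>0 'k::field) pmodule)"
    and t: "t \<in> P" "t \<in> Q"
    and conn: "zigzag_connected (P - {t})" "zigzag_connected (Q - {t})"
    and p: "p \<in> P - Q" "t \<le> p" and q: "q \<in> Q - {t}" "t \<le> q"
    and below: "\<And>x. x \<in> P \<inter> Q \<Longrightarrow> x \<noteq> t \<Longrightarrow> \<exists>y\<in>P - Q. y \<le> x"
  shows "indecomposable free_scale (glued_module P Q t :: (nat \<Rightarrow>\<^sub>0 'k::field) pmodule)"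
    (is "indecomposable _ ?M")
proof -
  interpret M: persistence_module free_scale ?M by fact
  show ?thesis
  proof (rule M.indecomposableI)
    have "t \<in> supp ?M" using t by (simp add: supp_glued_module)
    then show "\<not> zero_pmodule ?M" unfolding supp_def zero_pmodule_def by blast
  next
    fix e
    assume lin: "\<And>x. linear_on free_scale free_scale (Sp ?M x) (Sp ?M x) (e x)"
      and idem: "\<And>x v. v \<in> Sp ?M x \<Longrightarrow> e x (e x v) = e x v"
      and nat: "\<And>x y v. x \<le> y \<Longrightarrow> v \<in> Sp ?M x \<Longrightarrow> e y (Tr ?M x y v) = Tr ?M x y (e x v)"
    have mem: "vec2 a b \<in> Sp ?M x \<longleftrightarrow> (a \<noteq> 0 \<longrightarrow> x \<in> P) \<and> (b \<noteq> 0 \<longrightarrow> x \<in> Q) \<and> (x = t \<longrightarrow> a = b)" for a b x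
      by (auto simp: glued_module_def)
    have Tr: "Tr ?M x y (vec2 a b) = vec2 (if y \<in> P then a else 0) (if y \<in> Q then b else 0)" for x y a b
      by (simp add: glued_module_def)
    have add: "e x (u + v) = e x u + e x v" if "u \<in> Sp ?M x" "v \<in> Sp ?M x" for x u v
      using lin[of x] that unfolding linear_on_def by blast
    have scl: "e x (free_scale c v) = free_scale c (e x v)" if "v \<in> Sp ?M x" for x c v
      using lin[of x] that unfolding linear_on_def by blast
    have ex: "\<exists>c d. e x v = vec2 c d \<and> vec2 c d \<in> Sp ?M x" if "v \<in> Sp ?M x" for x v
    proof -
      have "e x v \<in> Sp ?M x" using lin[of x] that unfolding linear_on_def by blast
      then show ?thesis by (auto simp: glued_module_def)
    qed
    define \<alpha> where "\<alpha> x = Poly_Mapping.lookup (e x (vec2 1 0)) 0" for x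
    define \<beta> where "\<beta> x = Poly_Mapping.lookup (e x (vec2 0 1)) 1" for x
    obtain \<tau> where \<tau>: "e t (vec2 1 1) = vec2 \<tau> \<tau>"
      using ex[of "vec2 1 1" t] t by (auto simp: mem)
    have \<alpha>0: "e x (vec2 1 0) = vec2 (\<alpha> x) 0" if "x \<in> P - Q" for x
    proof -
      have "x \<noteq> t" using that t by blast
      then show ?thesis using ex[of "vec2 1 0" x] that by (auto simp: mem \<alpha>_def)
    qed
    have \<alpha>: "e x (vec2 1 0) = vec2 (\<alpha> x) 0" if x: "x \<in> P - {t}" for x
    proof (cases "x \<in> Q")
      case True
      \<comment> \<open>At a common point, \<open>vec2 1 0\<close> is the image of a vector from a
        point \<open>y\<close> where coordinate 0 is the whole space, so its image under
        \<open>e\<close> has no component in coordinate 1.\<close>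
      then obtain y where y: "y \<in> P - Q" "y \<le> x" using below x by blast
      have "e x (vec2 1 0) = vec2 (\<alpha> y) 0"
        using nat[OF y(2), of "vec2 1 0"] y(1) x t \<alpha>0[OF y(1)] by (auto simp: mem Tr)
      then show ?thesis by (simp add: \<alpha>_def)
    qed (use x \<alpha>0 in blast)
    have \<alpha>_mono: "\<alpha> x = \<alpha> y" if "x \<in> P - {t}" "y \<in> P - {t}" "x \<le> y" for x y
      using nat[OF that(3), of "vec2 1 0"] that \<alpha>[of x] \<alpha>[of y] by (auto simp: mem Tr)
    have \<beta>: "\<exists>\<mu>. e x (vec2 0 1) = vec2 \<mu> (\<beta> x) \<and> vec2 \<mu> (\<beta> x) \<in> Sp ?M x" if "x \<in> Q - {t}" for x
      using ex[of "vec2 0 1" x] that by (auto simp: mem \<beta>_def)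
    have \<beta>_mono: "\<beta> x = \<beta> y" if "x \<in> Q - {t}" "y \<in> Q - {t}" "x \<le> y" for x y
      using nat[OF that(3), of "vec2 0 1"] that \<beta>[of x] \<beta>[of y] by (auto simp: mem Tr)
    \<comment> \<open>Coordinate 1 dies on the way from \<open>t\<close> to \<open>p\<close>, so the
      diagonal vector becomes \<open>vec2 1 0\<close>.\<close>
    have "\<alpha> p = \<tau>"
      using nat[OF p(2), of "vec2 1 1"] p t \<tau> \<alpha>0[OF p(1)] by (auto simp: mem Tr)
    then have \<alpha>\<tau>: "e x (vec2 1 0) = vec2 \<tau> 0" if "x \<in> P - {t}" for x
    proof -
      have "\<alpha> p = \<alpha> x"
        by (rule zigzag_connected_const[OF conn(1)]) (use p t that \<alpha>_mono in blast)+
      then show ?thesis using \<alpha>[OF that] \<open>\<alpha> p = \<tau>\<close> by simp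
    qed
    \<comment> \<open>Compare coordinate 1 of the image of the diagonal vector. If \<open>q\<close>
      is also in \<open>P\<close>, coordinate 0 contributes nothing there, and the unknown \<mu>
      affects coordinate 0 only.\<close>
    have "\<beta> q = \<tau>"
    proof (cases "q \<in> P")
      case True
      have "e q (vec2 1 1) = e q (vec2 1 0) + e q (vec2 0 1)"
        using add[of "vec2 1 0" q "vec2 0 1"] q True by (simp add: mem)
      moreover have "e q (vec2 1 1) = vec2 \<tau> \<tau>"
        using nat[OF q(2), of "vec2 1 1"] q t True \<tau> by (auto simp: mem Tr)
      ultimately show ?thesis using \<alpha>\<tau>[of q] \<beta>[OF q(1)] True q by auto
    next
      case False
      then show ?thesis using nat[OF q(2), of "vec2 1 1"] q t \<tau> \<beta>[OF q(1)] by (auto simp: mem Tr)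
    qed
    then have \<beta>\<tau>: "\<exists>\<mu>. e x (vec2 0 1) = vec2 \<mu> \<tau> \<and> vec2 \<mu> \<tau> \<in> Sp ?M x" if "x \<in> Q - {t}" for x
    proof -
      have "\<beta> q = \<beta> x"
        by (rule zigzag_connected_const[OF conn(2)]) (use q that \<beta>_mono in blast)+
      then show ?thesis using \<beta>[OF that] \<open>\<beta> q = \<tau>\<close> by simp
    qed
    have "vec2 \<tau> \<tau> = vec2 (\<tau> * \<tau>) (\<tau> * \<tau>)"
      using idem[of "vec2 1 1" t] scl[of "vec2 1 1" t \<tau>] t \<tau> by (simp add: mem)
    then have \<tau>01: "\<tau> = 0 \<or> \<tau> = 1" by simp
    \<comment> \<open>The component \<mu> comes from a homomorphism from the module on
      \<open>Q\<close> to that on \<open>P\<close>. Idempotence gives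
      \<open>\<mu> = \<mu> * \<tau> + \<tau> * \<mu>\<close>, which forces \<open>\<mu> = 0\<close>
      for \<tau> equal to 0 or 1, in every characteristic.\<close>
    have \<beta>\<tau>': "e x (vec2 0 1) = vec2 0 \<tau>" if x: "x \<in> Q - {t}" for x
    proof -
      obtain \<mu> where \<mu>: "e x (vec2 0 1) = vec2 \<mu> \<tau>" "vec2 \<mu> \<tau> \<in> Sp ?M x" using \<beta>\<tau>[OF x] by blast
      have "\<mu> = 0" if "x \<in> P"
      proof -
        have "vec2 \<mu> \<tau> = e x (vec2 \<mu> \<tau>)" using idem[of "vec2 0 1" x] \<mu> x by (simp add: mem)
        also have "\<dots> = e x (free_scale \<mu> (vec2 1 0) + free_scale \<tau> (vec2 0 1))" by simp
        also have "\<dots> = free_scale \<mu> (vec2 \<tau> 0) + free_scale \<tau> (vec2 \<mu> \<tau>)"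
          using x that \<mu> \<alpha>\<tau>[of x] by (subst add) (auto simp: mem scl simp del: vec2_scale, simp_all add: mem)
        finally have "\<mu> = \<mu> * \<tau> + \<tau> * \<mu>" by simp
        then show ?thesis using \<tau>01 add_cancel_right_right[of \<mu> \<mu>] by (elim disjE) simp_all
      qed
      then show ?thesis using \<mu> by (auto simp: mem)
    qed
    have "e x v = free_scale \<tau> v" if v: "v \<in> Sp ?M x" for x v
    proof -
      obtain a b where ab: "v = vec2 a b" "vec2 a b \<in> Sp ?M x" using v by (auto simp: glued_module_def)
      consider "x = t" | "x \<noteq> t" by blast
      then show ?thesis
      proof cases
        case 1
        then show ?thesis using ab scl[of "vec2 1 1" t a] t \<tau> by (simp add: mem mult.commute)
      next
        case 2
        have A: "e x (vec2 a 0) = vec2 (\<tau> * a) 0"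
        proof (cases "a = 0")
          case False
          then show ?thesis using scl[of "vec2 1 0" x a] \<alpha>\<tau>[of x] 2 ab by (simp add: mem mult.commute)
        next
          case True
          then show ?thesis using scl[of "vec2 0 0" x 0] mem[of 0 0 x] by (simp add: vec2_0)
        qed
        have B: "e x (vec2 0 b) = vec2 0 (\<tau> * b)"
        proof (cases "b = 0")
          case False
          then show ?thesis using scl[of "vec2 0 1" x b] \<beta>\<tau>'[of x] 2 ab by (simp add: mem mult.commute)
        next
          case True
          then show ?thesis using scl[of "vec2 0 0" x 0] mem[of 0 0 x] by (simp add: vec2_0)
        qed
        show ?thesis using add[of "vec2 a 0" x "vec2 0 b"] A B ab 2 by (simp add: mem)
      qed
    qed
    then show "(\<forall>x. \<forall>v\<in>Sp ?M x. e x v = 0) \<or> (\<forall>x. \<forall>v\<in>Sp ?M x. e x v = v)"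
      using \<tau>01 by auto
  qed
qed

section \<open>The staircases and their union\<close>

text \<open>
  The upper bound \<open>2n + 1\<close> adds a free end to each staircase behind the last corner.  On the lower
  one, this puts a point that is not on the upper one below every common corner, the last one included.
\<close>

definition lower_staircase :: "nat \<Rightarrow> (int \<times> int) set" where
  "lower_staircase n = {(x, y). 0 \<le> x \<and> x \<le> 2 * int n + 1 \<and> - 2 * int n - 1 \<le> y \<and> y \<le> 0 \<and>
       - 2 \<le> x + y \<and> x + y \<le> 0 \<and> (even x \<or> even y)} \<union> {(- 1, 0), (- 1, 1), (0, 1)}"

definition upper_staircase :: "nat \<Rightarrow> (int \<times> int) set" where
  "upper_staircase n = {(x, y). 0 \<le> x \<and> x \<le> 2 * int n + 1 \<and> - 2 * int n - 1 \<le> y \<and> y \<le> 0 \<and>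
       0 \<le> x + y \<and> x + y \<le> 2 \<and> (even x \<or> even y)} \<union> {(- 1, 0)}"

text \<open>The parity condition removes the ring centres \<open>(2i + 1, -2i - 1)\<close> and the
  odd points on the borders of the strip. The bounds cut off the ring after the corner
  \<open>(2n, -2n)\<close> and leave only its two free ends.\<close>

definition ring_chain :: "nat \<Rightarrow> (int \<times> int) set" where
  "ring_chain n = {(x, y). 0 \<le> x \<and> x \<le> 2 * int n + 1 \<and> - 2 * int n - 1 \<le> y \<and> y \<le> 0 \<and>
       \<bar>x + y\<bar> \<le> 2 \<and> (even x \<or> even y)} \<union> {(- 1, 0), (- 1, 1), (0, 1)}"

lemma in_ring_chain:
  "(x, y) \<in> ring_chain n \<longleftrightarrow>
     0 \<le> x \<and> x \<le> 2 * int n + 1 \<and> - 2 * int n - 1 \<le> y \<and> y \<le> 0 \<and> \<bar>x + y\<bar> \<le> 2 \<and> (even x \<or> even y)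
     \<or> x = - 1 \<and> y = 0 \<or> x = - 1 \<and> y = 1 \<or> x = 0 \<and> y = 1"
  by (auto simp: ring_chain_def)

lemma lower_Un_upper: "lower_staircase n \<union> upper_staircase n = ring_chain n"
  by (auto simp: lower_staircase_def upper_staircase_def ring_chain_def)

lemma finite_ring_chain: "finite (ring_chain n)"
proof (rule finite_subset)
  show "ring_chain n \<subseteq> {- 1..2 * int n + 1} \<times> {- 2 * int n - 1..1}"
    by (auto simp: ring_chain_def)
qed simp

lemma ring_chain_bounds: "(x, y) \<in> ring_chain n \<Longrightarrow> - 1 \<le> x \<and> y \<le> 1"
  by (auto simp: ring_chain_def)

lemma ring_chain_odd: "(x, y) \<in> ring_chain n \<Longrightarrow> odd x \<Longrightarrow> odd y \<Longrightarrow> x = - 1 \<and> y = 1"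
  by (auto simp: ring_chain_def)

text \<open>Every unit square has a vertex with both coordinates odd, and the only such point of the
  support is \<open>(-1, 1)\<close>. Of the four squares around it, the bounds on the support leave
  one.\<close>

lemma squares_ring_chain: "squares (ring_chain n) = {(- 1, 0)}"
proof -
  have "squares (ring_chain n) \<subseteq> {(- 1, 0)}"
  proof (rule subrelI)
    fix x y assume "(x, y) \<in> squares (ring_chain n)"
    then have *: "(x, y) \<in> ring_chain n" "(x, y + 1) \<in> ring_chain n"
      "(x + 1, y + 1) \<in> ring_chain n" "(x + 1, y) \<in> ring_chain n"
      by (auto simp: squares_def)
    have "- 2 \<le> x \<and> x \<le> - 1 \<and> 0 \<le> y \<and> y \<le> 1"
    proof (cases "even x"; cases "even y")
      assume "even x" "even y"
      then show ?thesis using ring_chain_odd[OF *(3)] by simp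
    next
      assume "even x" "odd y"
      then show ?thesis using ring_chain_odd[OF *(4)] by simp
    next
      assume "odd x" "even y"
      then show ?thesis using ring_chain_odd[OF *(2)] by simp
    next
      assume "odd x" "odd y"
      then show ?thesis using ring_chain_odd[OF *(1)] by simp
    qed
    then have "x = - 1" "y = 0" using ring_chain_bounds[OF *(1)] ring_chain_bounds[OF *(2)] by linarith+
    then show "(x, y) \<in> {(- 1, 0)}" by simp
  qed
  moreover have "(- 1, 0) \<in> squares (ring_chain n)" by (simp add: squares_def ring_chain_def)
  ultimately show ?thesis by (intro equalityI) simp_all
qed

section \<open>Boundary maps in coordinates\<close>

text \<open>Flow into a vertex minus flow out of it. The hypothesis on the keys excludes pairs of
  points that are not grid edges, which could also contribute at the vertex.\<close>

lemma lookup_bdry1: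
  assumes "Poly_Mapping.keys f \<subseteq> edges S"
  shows "Poly_Mapping.lookup (bdry1 f) (x, y) =
    Poly_Mapping.lookup f ((x - 1, y), (x, y)) + Poly_Mapping.lookup f ((x, y - 1), (x, y))
    - Poly_Mapping.lookup f ((x, y), (x + 1, y)) - Poly_Mapping.lookup f ((x, y), (x, y + 1))"
proof -
  let ?E = "{((x - 1, y), (x, y)), ((x, y - 1), (x, y)), ((x, y), (x + 1, y)), ((x, y), (x, y + 1))}"
  let ?K = "Poly_Mapping.keys f \<union> ?E"
  let ?h = "\<lambda>b. Poly_Mapping.lookup f b * Poly_Mapping.lookup
    (case b of (p, q) \<Rightarrow> Poly_Mapping.single q 1 - Poly_Mapping.single p 1) (x, y)"
  have "Poly_Mapping.lookup (bdry1 f) (x, y) = (\<Sum>b\<in>?K. ?h b)"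
    unfolding bdry1_def by (subst linear_ext_superset[of ?K]) (auto simp: lookup_sum)
  also have "\<dots> = (\<Sum>b\<in>?E. ?h b)"
  proof (rule sum.mono_neutral_right)
    show "\<forall>b\<in>?K - ?E. ?h b = 0"
    proof
      fix b assume b: "b \<in> ?K - ?E"
      then have "b \<in> edges S" using assms by blast
      then show "?h b = 0" using b by (cases b) (auto simp: edges_def lookup_minus lookup_single when_def)
    qed
  qed auto
  also have "\<dots> = Poly_Mapping.lookup f ((x - 1, y), (x, y)) + Poly_Mapping.lookup f ((x, y - 1), (x, y))
    - Poly_Mapping.lookup f ((x, y), (x + 1, y)) - Poly_Mapping.lookup f ((x, y), (x, y + 1))"
    by (simp add: lookup_minus lookup_single)
  finally show ?thesis .
qed

lemma lookup_bdry2_aux: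
  "Poly_Mapping.lookup (bdry2 g) e = (\<Sum>(i, j)\<in>Poly_Mapping.keys g. Poly_Mapping.lookup g (i, j) *
    (of_bool (e = ((i, j), (i + 1, j))) + of_bool (e = ((i + 1, j), (i + 1, j + 1)))
     - of_bool (e = ((i, j + 1), (i + 1, j + 1))) - of_bool (e = ((i, j), (i, j + 1)))))"
  unfolding bdry2_def linear_ext_def lookup_sum
  by (rule sum.cong) (auto simp: lookup_add lookup_minus lookup_single when_def)

text \<open>The edge is the bottom of the square above it and the top of the square below it, so the
  coefficient is the jump of \<open>g\<close> across the edge.\<close>

lemma lookup_bdry2_horizontal:
  "Poly_Mapping.lookup (bdry2 g) ((x, y), (x + 1, y)) =
    Poly_Mapping.lookup g (x, y) - Poly_Mapping.lookup g (x, y - 1)"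
proof -
  have "Poly_Mapping.lookup (bdry2 g) ((x, y), (x + 1, y)) =
    (\<Sum>p\<in>Poly_Mapping.keys g. (if p = (x, y) then Poly_Mapping.lookup g p else 0)
       - (if p = (x, y - 1) then Poly_Mapping.lookup g p else 0))"
    unfolding lookup_bdry2_aux by (rule sum.cong) auto
  also have "\<dots> = Poly_Mapping.lookup g (x, y) - Poly_Mapping.lookup g (x, y - 1)"
    by (simp add: sum_subtractf sum.delta in_keys_iff)
  finally show ?thesis .
qed

lemma lookup_bdry2_vertical:
  "Poly_Mapping.lookup (bdry2 g) ((x, y), (x, y + 1)) =
    Poly_Mapping.lookup g (x - 1, y) - Poly_Mapping.lookup g (x, y)"
proof -
  have "Poly_Mapping.lookup (bdry2 g) ((x, y), (x, y + 1)) =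
    (\<Sum>p\<in>Poly_Mapping.keys g. (if p = (x - 1, y) then Poly_Mapping.lookup g p else 0)
       - (if p = (x, y) then Poly_Mapping.lookup g p else 0))"
    unfolding lookup_bdry2_aux by (rule sum.cong) auto
  also have "\<dots> = Poly_Mapping.lookup g (x - 1, y) - Poly_Mapping.lookup g (x, y)"
    by (simp add: sum_subtractf sum.delta in_keys_iff)
  finally show ?thesis .
qed

lemma keys_bdry2_cases:
  assumes "e \<in> Poly_Mapping.keys (bdry2 g)"
  obtains (horizontal) x y where "e = ((x, y), (x + 1, y))"
      "Poly_Mapping.lookup g (x, y) \<noteq> Poly_Mapping.lookup g (x, y - 1)"
    | (vertical) x y where "e = ((x, y), (x, y + 1))"
      "Poly_Mapping.lookup g (x - 1, y) \<noteq> Poly_Mapping.lookup g (x, y)"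
proof -
  have ne: "Poly_Mapping.lookup (bdry2 g) e \<noteq> 0" using assms by (simp add: in_keys_iff)
  then have "(\<exists>x y. e = ((x, y), (x + 1, y))) \<or> (\<exists>x y. e = ((x, y), (x, y + 1)))"
  proof (rule contrapos_np)
    assume "\<not> ((\<exists>x y. e = ((x, y), (x + 1, y))) \<or> (\<exists>x y. e = ((x, y), (x, y + 1))))"
    then show "Poly_Mapping.lookup (bdry2 g) e = 0"
      unfolding lookup_bdry2_aux by (intro sum.neutral ballI) (auto split: prod.split)
  qed
  then show ?thesis
    using ne that by (auto simp: lookup_bdry2_horizontal lookup_bdry2_vertical)
qed

section \<open>Cycles, dual functionals and the dimension of the homology\<close>

text \<open>The classes of the \<open>c i\<close> form a basis with dual basis \<phi>. Applying
  \<open>\<phi> j\<close> to a combination in \<open>B\<close> gives independence. For spanning,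
  subtract the combination with coefficients \<open>\<phi> i z\<close>; the remainder is killed by
  every functional and so lies in \<open>B\<close>.\<close>

lemma quotient_has_dim_dual:
  fixes c :: "nat \<Rightarrow> ('b \<Rightarrow>\<^sub>0 'k::field)" and \<phi> :: "nat \<Rightarrow> ('b \<Rightarrow>\<^sub>0 'k) \<Rightarrow> 'k"
  assumes Z: "free.subspace Z" "\<And>i. i < n \<Longrightarrow> c i \<in> Z"
    and add: "\<And>j f g. \<phi> j (f + g) = \<phi> j f + \<phi> j g"
    and scale: "\<And>j a f. \<phi> j (free_scale a f) = a * \<phi> j f"
    and dual: "\<And>i j. i < n \<Longrightarrow> j < n \<Longrightarrow> \<phi> j (c i) = of_bool (i = j)"
    and van: "\<And>j f. j < n \<Longrightarrow> f \<in> B \<Longrightarrow> \<phi> j f = 0"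
    and ker: "\<And>f. f \<in> Z \<Longrightarrow> (\<And>j. j < n \<Longrightarrow> \<phi> j f = 0) \<Longrightarrow> f \<in> B"
  shows "quotient_has_dim free_scale Z B n"
proof -
  interpret \<phi>: Vector_Spaces.linear free_scale "(*) :: 'k \<Rightarrow> 'k \<Rightarrow> 'k" "\<phi> j" for j
    by unfold_locales (simp_all add: add scale algebra_simps)
  have inj: "inj_on c {..<n}"
  proof (rule inj_onI)
    fix i j assume "i \<in> {..<n}" "j \<in> {..<n}" "c i = c j"
    then show "i = j" using dual[of i i] dual[of j i] by (cases "j = i") auto
  qed
  have sum_c: "(\<Sum>v\<in>c ` {..<n}. free_scale (u v) v) = (\<Sum>i<n. free_scale (u (c i)) (c i))" for u
    using inj by (simp add: sum.reindex)
  have \<phi>_sum: "\<phi> j (\<Sum>i<n. free_scale (w i) (c i)) = w j" if "j < n" for w j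
  proof -
    have "\<phi> j (\<Sum>i<n. free_scale (w i) (c i)) = (\<Sum>i<n. if i = j then w i else 0)"
      using that by (auto simp: \<phi>.sum scale dual intro!: sum.cong)
    then show ?thesis using that by simp
  qed
  have "\<exists>u. z - (\<Sum>v\<in>c ` {..<n}. free_scale (u v) v) \<in> B" if "z \<in> Z" for z
  proof
    \<comment> \<open>\<open>quotient_has_dim\<close> indexes coefficients by the vectors, so the
      index is recovered from the vector.\<close>
    let ?u = "\<lambda>v. \<phi> (inv_into {..<n} c v) z"
    have *: "(\<Sum>v\<in>c ` {..<n}. free_scale (?u v) v) = (\<Sum>i<n. free_scale (\<phi> i z) (c i))"
      unfolding sum_c by (rule sum.cong) (simp_all add: inv_into_f_f[OF inj])
    show "z - (\<Sum>v\<in>c ` {..<n}. free_scale (?u v) v) \<in> B"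
      unfolding * using Z that
      by (intro ker free.subspace_diff free.subspace_sum free.subspace_scale) (auto simp: \<phi>.diff \<phi>_sum)
  qed
  moreover have "u v = 0" if "(\<Sum>v\<in>c ` {..<n}. free_scale (u v) v) \<in> B" "v \<in> c ` {..<n}" for u v
    using that van \<phi>_sum[of _ "\<lambda>i. u (c i)"] unfolding sum_c by fastforce
  ultimately show ?thesis
    unfolding quotient_has_dim_def using Z(2) inj
    by (intro exI[of _ "c ` {..<n}"]) (auto simp: card_image)
qed

lemma subspace_cycles1: "free.subspace (cycles1 S)"
proof -
  interpret d: Vector_Spaces.linear free_scale free_scale
    "bdry1 :: ((int \<times> int) \<times> (int \<times> int) \<Rightarrow>\<^sub>0 'a) \<Rightarrow> _"
    unfolding bdry1_def by (rule linear_ext_linear)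
  have scale: "Poly_Mapping.keys (free_scale c f) \<subseteq> A" if "Poly_Mapping.keys f \<subseteq> A"
    for A c and f :: "'b \<Rightarrow>\<^sub>0 'a"
    using that by (auto simp: in_keys_iff)
  have add: "Poly_Mapping.keys (f + g) \<subseteq> A"
    if "Poly_Mapping.keys f \<subseteq> A" "Poly_Mapping.keys g \<subseteq> A" for A and f g :: "'b \<Rightarrow>\<^sub>0 'a"
    using Poly_Mapping.keys_add[of f g] that by blast
  show ?thesis
    unfolding free.subspace_def cycles1_def by (simp add: d.add d.scale d.zero add scale)
qed

text \<open>The lower left corners of the four squares around the missing point
  \<open>(2i + 1, -2i - 1)\<close>. None of these squares is in the complex, so the boundary of
  their sum need not be a boundary there.\<close>

definition ring_block :: "nat \<Rightarrow> (int \<times> int) set" where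
  "ring_block i = {2 * int i, 2 * int i + 1} \<times> {- 2 * int i - 2, - 2 * int i - 1}"

text \<open>The boundary of a 2x2 block of squares runs once around the hole in its centre.\<close>

definition ring_cycle :: "nat \<Rightarrow> ((int \<times> int) \<times> (int \<times> int) \<Rightarrow>\<^sub>0 'k::field)" where
  "ring_cycle i = bdry2 (\<Sum>p\<in>ring_block i. Poly_Mapping.single p 1)"

lemma lookup_ring_block:
  "Poly_Mapping.lookup (\<Sum>p\<in>ring_block i. Poly_Mapping.single p (1::'k::field)) q = of_bool (q \<in> ring_block i)"
proof -
  have "finite (ring_block i)" by (simp add: ring_block_def)
  then show ?thesis by (simp add: lookup_sum lookup_single when_def)
qed

text \<open>The inner edges of the block cancel. The coefficient jumps only across its outer edges,
  and these lie on the ring.\<close>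

lemma ring_cycle_in_cycles1:
  assumes "i < n"
  shows "(ring_cycle i :: _ \<Rightarrow>\<^sub>0 'k::field) \<in> cycles1 (ring_chain n)"
proof -
  have "e \<in> edges (ring_chain n)" if "e \<in> Poly_Mapping.keys (ring_cycle i :: _ \<Rightarrow>\<^sub>0 'k)" for e
    using that unfolding ring_cycle_def
  proof (cases rule: keys_bdry2_cases)
    case (horizontal x y)
    from horizontal(2)
    have "(x = 2 * int i \<or> x = 2 * int i + 1) \<and> (y = - 2 * int i - 2 \<or> y = - 2 * int i)"
      unfolding lookup_ring_block of_bool_eq_iff unfolding ring_block_def by auto
    then show ?thesis using assms unfolding horizontal(1)
      by (elim conjE disjE; simp add: edges_def in_ring_chain)
  next
    case (vertical x y)
    from vertical(2)
    have "(x = 2 * int i \<or> x = 2 * int i + 2) \<and> (y = - 2 * int i - 2 \<or> y = - 2 * int i - 1)"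
      unfolding lookup_ring_block of_bool_eq_iff unfolding ring_block_def by auto
    then show ?thesis using assms unfolding vertical(1)
      by (elim conjE disjE; simp add: edges_def in_ring_chain)
  qed
  then have "Poly_Mapping.keys (ring_cycle i :: _ \<Rightarrow>\<^sub>0 'k) \<subseteq> edges (ring_chain n)" by blast
  then show ?thesis by (simp add: cycles1_def ring_cycle_def bdry1_bdry2)
qed

lemma lookup_horizontal_eq_0:
  assumes "Poly_Mapping.keys f \<subseteq> edges (ring_chain n)" "(x, y) \<notin> ring_chain n \<or> (x + 1, y) \<notin> ring_chain n"
  shows "Poly_Mapping.lookup f ((x, y), (x + 1, y)) = 0"
proof -
  have "((x, y), (x + 1, y)) \<notin> edges (ring_chain n)" using assms(2) by (simp add: edges_def)
  then have "((x, y), (x + 1, y)) \<notin> Poly_Mapping.keys f" using assms(1) by blast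
  then show ?thesis by (simp add: in_keys_iff)
qed

lemma lookup_vertical_eq_0:
  assumes "Poly_Mapping.keys f \<subseteq> edges (ring_chain n)" "(x, y) \<notin> ring_chain n \<or> (x, y + 1) \<notin> ring_chain n"
  shows "Poly_Mapping.lookup f ((x, y), (x, y + 1)) = 0"
proof -
  have "((x, y), (x, y + 1)) \<notin> edges (ring_chain n)" using assms(2) by (simp add: edges_def)
  then have "((x, y), (x, y + 1)) \<notin> Poly_Mapping.keys f" using assms(1) by blast
  then show ?thesis by (simp add: in_keys_iff)
qed

text \<open>Removing the given edges turns the support into a tree, and a cycle on a tree vanishes.\<close>

lemma ring_chain_cycle_eq_0:
  fixes f :: "(int \<times> int) \<times> (int \<times> int) \<Rightarrow>\<^sub>0 'k::field"
  assumes f: "f \<in> cycles1 (ring_chain n)"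
    and sq: "Poly_Mapping.lookup f ((- 1, 0), (- 1, 1)) = 0"
    and ring: "\<And>i. i < n \<Longrightarrow> Poly_Mapping.lookup f ((2 * int i, - 2 * int i - 1), (2 * int i, - 2 * int i)) = 0"
  shows "f = 0"
proof -
  have keys: "Poly_Mapping.keys f \<subseteq> edges (ring_chain n)" and "bdry1 f = 0"
    using f by (auto simp: cycles1_def)
  define h where "h x y = Poly_Mapping.lookup f ((x, y), (x + 1, y))" for x y
  define v where "v x y = Poly_Mapping.lookup f ((x, y), (x, y + 1))" for x y
  have bal: "h (x - 1) y + v x (y - 1) = h x y + v x y" for x y
  proof -
    have "Poly_Mapping.lookup (bdry1 f) (x, y) = 0" using \<open>bdry1 f = 0\<close> by simp
    then show ?thesis unfolding lookup_bdry1[OF keys] h_def v_def by (simp add: algebra_simps)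
  qed
  have h0: "h x y = 0" if "(x, y) \<notin> ring_chain n \<or> (x + 1, y) \<notin> ring_chain n" for x y
    unfolding h_def by (rule lookup_horizontal_eq_0[OF keys that])
  have v0: "v x y = 0" if "(x, y) \<notin> ring_chain n \<or> (x, y + 1) \<notin> ring_chain n" for x y
    unfolding v_def by (rule lookup_vertical_eq_0[OF keys that])
  \<comment> \<open>If three of the four edges at a vertex carry no flow, neither does the fourth.
    The neighbouring coordinates are separate variables, so that the rules match terms such as
    \<open>- 2 * i - 3\<close>.\<close>
  have hI: "h x y = 0" if "h a y = 0" "v x b = 0" "v x y = 0" "a = x - 1" "b = y - 1" for a x b y
    using bal[of x y] that by simp
  have vI: "v x y = 0" if "h a y = 0" "v x b = 0" "h x y = 0" "a = x - 1" "b = y - 1" for a x b y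
    using bal[of x y] that by simp
  have v'I: "v x b = 0" if "h a y = 0" "h x y = 0" "v x y = 0" "a = x - 1" "b = y - 1" for a x b y
    using bal[of x y] that by simp
  have v_sq: "v (- 1) 0 = 0" using sq by (simp add: v_def)
  \<comment> \<open>Around the filled square from its left side: through \<open>(-1, 0)\<close> to
    the bottom, and through \<open>(-1, 1)\<close> and \<open>(0, 1)\<close> to the top and the
    right side.\<close>
  have h_sq: "h (- 1) 0 = 0"
    by (rule hI[of "- 2" _ _ "- 1"]) (simp_all add: v_sq h0 v0 in_ring_chain)
  have h_sq': "h (- 1) 1 = 0"
    by (rule hI[of "- 2" _ _ 0]) (simp_all add: v_sq h0 v0 in_ring_chain)
  have v_sq': "v 0 0 = 0"
    by (rule v'I[of "- 1" 1 0]) (simp_all add: h_sq' h0 v0 in_ring_chain)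
  \<comment> \<open>The edge just below the corner \<open>(2i, -2i)\<close>: removed by assumption
    for \<open>i < n\<close>, and ending in a leaf for \<open>i = n\<close>.\<close>
  have left1: "v (2 * i) (- 2 * i - 1) = 0" if "0 \<le> i" "i \<le> int n" for i
  proof (cases "i = int n")
    case True
    have z: "h (2 * i - 1) (- 2 * i - 1) = 0" "h (2 * i) (- 2 * i - 1) = 0" "v (2 * i) (- 2 * i - 2) = 0"
      using that True by (auto intro!: h0 v0 simp: in_ring_chain)
    show ?thesis by (rule vI[OF z(1,3,2)]) simp_all
  next
    case False
    then show ?thesis using ring[of "nat i"] that by (simp add: v_def)
  qed
  \<comment> \<open>From there down the left side of ring \<open>i\<close> and along its bottom to
    the next corner.\<close>
  have left2: "v (2 * i) (- 2 * i - 2) = 0" if "0 \<le> i" "i < int n" for i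
  proof -
    have "h (2 * i - 1) (- 2 * i - 1) = 0" "h (2 * i) (- 2 * i - 1) = 0"
      using that by (auto intro!: h0 simp: in_ring_chain)
    then show ?thesis by (rule v'I) (use that left1[of i] in simp_all)
  qed
  have left3: "h (2 * i) (- 2 * i - 2) = 0" if "0 \<le> i" "i < int n" for i
  proof -
    have "h (2 * i - 1) (- 2 * i - 2) = 0" "v (2 * i) (- 2 * i - 3) = 0"
      using that by (auto intro!: h0 v0 simp: in_ring_chain)
    then show ?thesis by (rule hI) (use that left2[of i] in simp_all)
  qed
  have left4: "h (2 * i + 1) (- 2 * i - 2) = 0" if "0 \<le> i" "i < int n" for i
  proof -
    have "v (2 * i + 1) (- 2 * i - 3) = 0" "v (2 * i + 1) (- 2 * i - 2) = 0"
      using that by (auto intro!: v0 simp: in_ring_chain)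
    then show ?thesis by (rule hI[OF left3[OF that]]) simp_all
  qed
  \<comment> \<open>The other half of ring \<open>i\<close>, along its top and down its right side,
    once the first top edge is known to vanish.\<close>
  have right: "h (2 * i + 1) (- 2 * i) = 0 \<and> v (2 * i + 2) (- 2 * i - 1) = 0 \<and> v (2 * i + 2) (- 2 * i - 2) = 0"
    if "0 \<le> i" "i < int n" "h (2 * i) (- 2 * i) = 0" for i
  proof -
    have z1: "v (2 * i + 1) (- 2 * i - 1) = 0" "v (2 * i + 1) (- 2 * i) = 0"
      using that by (auto intro!: v0 simp: in_ring_chain)
    have h1: "h (2 * i + 1) (- 2 * i) = 0" by (rule hI[OF that(3) z1]) simp_all
    have z2: "h (2 * i + 2) (- 2 * i) = 0" "v (2 * i + 2) (- 2 * i) = 0"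
      using that v_sq' by (auto intro!: h0 v0 simp: in_ring_chain)
    have v1: "v (2 * i + 2) (- 2 * i - 1) = 0" by (rule v'I[OF h1 z2]) simp_all
    have z3: "h (2 * i + 1) (- 2 * i - 1) = 0" "h (2 * i + 2) (- 2 * i - 1) = 0"
      using that by (auto intro!: h0 simp: in_ring_chain)
    have "v (2 * i + 2) (- 2 * i - 2) = 0" by (rule v'I[OF z3 v1]) simp_all
    with h1 v1 show ?thesis by blast
  qed
  \<comment> \<open>At each corner the edges to the left, above and below already vanish, hence so
    does the edge to the right. At the first corner the left and upper edges belong to the filled
    square; at the others they belong to the previous ring.\<close>
  have right1: "h (2 * int j) (- 2 * int j) = 0" if "j \<le> n" for j
    using that
  proof (induction j)
    case 0
    have "v 0 (- 1) = 0" using left1[of 0] by simp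
    then have "h 0 0 = 0" by (rule hI[OF h_sq]) (simp_all add: v_sq')
    then show ?case by simp
  next
    case (Suc j)
    have eq: "2 * int (Suc j) = 2 * int j + 2" "- 2 * int (Suc j) = - 2 * int j - 2"
      "- 2 * int j - 2 - 1 = - 2 * int j - 3" by simp_all
    have l1: "v (2 * int j + 2) (- 2 * int j - 3) = 0"
      using left1[of "int (Suc j)", unfolded eq] Suc.prems by simp
    have r4: "v (2 * int j + 2) (- 2 * int j - 2) = 0" using right[of "int j"] Suc by simp
    have l4: "h (2 * int j + 1) (- 2 * int j - 2) = 0" using left4[of "int j"] Suc.prems by simp
    have "h (2 * int j + 2) (- 2 * int j - 2) = 0" by (rule hI[OF l4 l1 r4]) simp_all
    then show ?case unfolding eq .
  qed
  have right1: "h (2 * i) (- 2 * i) = 0" if "0 \<le> i" "i \<le> int n" for i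
    using right1[of "nat i"] that by simp
  have hz: "h x y = 0" for x y
  proof (rule ccontr)
    assume nz: "h x y \<noteq> 0"
    then have m: "(x, y) \<in> ring_chain n" "(x + 1, y) \<in> ring_chain n" using h0 by blast+
    have ne: "\<not> (x = - 1 \<and> y = 0)" "\<not> (x = - 1 \<and> y = 1)" using nz h_sq h_sq' by metis+
    have y: "0 \<le> x \<and> x \<le> 2 * int n \<and> y \<le> 0 \<and> - 2 * int n - 1 \<le> y \<and> even y \<and> - 2 \<le> x + y \<and> x + y \<le> 1"
      using m ne unfolding in_ring_chain abs_le_iff by presburger
    then obtain j where "- y = 2 * j" by (metis even_minus evenE)
    then have j: "y = - 2 * j" by simp
    \<comment> \<open>The horizontal edges in this row lie on the top of ring \<open>j\<close>, or
      its free end, and on the bottom of ring \<open>j - 1\<close>.\<close>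
    consider "x = 2 * j" | "x = 2 * j + 1" | "x = 2 * (j - 1)" | "x = 2 * (j - 1) + 1"
      using y j by atomize_elim presburger
    then show False
    proof cases
      case 1
      then have "h x y = h (2 * j) (- 2 * j)" using j by simp
      also have "\<dots> = 0" by (rule right1) (use 1 y j in presburger)+
      finally show ?thesis using nz by simp
    next
      case 2
      then have "h x y = h (2 * j + 1) (- 2 * j)" using j by simp
      also have "\<dots> = 0" using right[of j] right1[of j] 2 y j by simp
      finally show ?thesis using nz by simp
    next
      case 3
      then have "h x y = h (2 * (j - 1)) (- 2 * (j - 1) - 2)" using j by simp
      also have "\<dots> = 0" by (rule left3) (use 3 y j in presburger)+
      finally show ?thesis using nz by simp
    next
      case 4
      then have "h x y = h (2 * (j - 1) + 1) (- 2 * (j - 1) - 2)" using j by simp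
      also have "\<dots> = 0" by (rule left4) (use 4 y j in presburger)+
      finally show ?thesis using nz by simp
    qed
  qed
  have vz: "v x y = 0" for x y
  proof (rule ccontr)
    assume nz: "v x y \<noteq> 0"
    then have m: "(x, y) \<in> ring_chain n" "(x, y + 1) \<in> ring_chain n" using v0 by blast+
    have ne: "\<not> (x = - 1 \<and> y = 0)" "\<not> (x = 0 \<and> y = 0)" using nz v_sq v_sq' by metis+
    have y: "0 \<le> x \<and> x \<le> 2 * int n + 1 \<and> y \<le> - 1 \<and> - 2 * int n - 1 \<le> y \<and> even x \<and> - 2 \<le> x + y \<and> x + y \<le> 1"
      using m ne unfolding in_ring_chain abs_le_iff by presburger
    then obtain j where j: "x = 2 * j" by blast
    \<comment> \<open>The vertical edges in this column lie on the left side of ring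
      \<open>j\<close>, or its free end, and on the right side of ring \<open>j - 1\<close>.\<close>
    consider "y = - 2 * j - 1" | "y = - 2 * j - 2" | "y = - 2 * (j - 1) - 1" | "y = - 2 * (j - 1) - 2"
      using y j by atomize_elim presburger
    then show False
    proof cases
      case 1
      then have "v x y = v (2 * j) (- 2 * j - 1)" using j by simp
      also have "\<dots> = 0" by (rule left1) (use 1 y j in presburger)+
      finally show ?thesis using nz by simp
    next
      case 2
      then have "v x y = v (2 * j) (- 2 * j - 2)" using j by simp
      also have "\<dots> = 0" by (rule left2) (use 2 y j in presburger)+
      finally show ?thesis using nz by simp
    next
      case 3
      have b: "0 \<le> j - 1" "j - 1 < int n" using 3 y j by presburger+
      have "v x y = v (2 * (j - 1) + 2) (- 2 * (j - 1) - 1)" using 3 j by simp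
      also have "\<dots> = 0" using right[OF b] right1[of "j - 1"] b by simp
      finally show ?thesis using nz by simp
    next
      case 4
      have b: "0 \<le> j - 1" "j - 1 < int n" using 4 y j by presburger+
      have "v x y = v (2 * (j - 1) + 2) (- 2 * (j - 1) - 2)" using 4 j by simp
      also have "\<dots> = 0" using right[OF b] right1[of "j - 1"] b by simp
      finally show ?thesis using nz by simp
    qed
  qed
  show "f = 0"
  proof (rule poly_mapping_eqI)
    fix e
    show "Poly_Mapping.lookup f e = Poly_Mapping.lookup 0 e"
    proof (cases "e \<in> edges (ring_chain n)")
      case True
      then show ?thesis using hz vz by (auto simp: edges_def h_def v_def)
    next
      case False
      then show ?thesis using keys by (auto simp: in_keys_iff)
    qed
  qed
qed

section \<open>Convexity and connectedness of the staircases\<close>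

lemma in_lower:
  "(x, y) \<in> lower_staircase n \<longleftrightarrow>
     0 \<le> x \<and> x \<le> 2 * int n + 1 \<and> - 2 * int n - 1 \<le> y \<and> y \<le> 0 \<and> - 2 \<le> x + y \<and> x + y \<le> 0 \<and> (even x \<or> even y)
     \<or> x = - 1 \<and> y = 0 \<or> x = - 1 \<and> y = 1 \<or> x = 0 \<and> y = 1"
  by (auto simp: lower_staircase_def)

lemma in_upper:
  "(x, y) \<in> upper_staircase n \<longleftrightarrow>
     0 \<le> x \<and> x \<le> 2 * int n + 1 \<and> - 2 * int n - 1 \<le> y \<and> y \<le> 0 \<and> 0 \<le> x + y \<and> x + y \<le> 2 \<and> (even x \<or> even y)
     \<or> x = - 1 \<and> y = 0"
  by (auto simp: upper_staircase_def)

text \<open>If \<open>b\<close> and \<open>b'\<close> are both odd, their sum is even and equals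
  \<open>s\<close> or \<open>s + 2\<close>, the borders of the strip. There the point coincides with
  the lower or the upper end of the interval, which has an even coordinate.\<close>

lemma parity_between:
  fixes a b c s :: int
  assumes "even a \<or> even a'" "even c \<or> even c'" "a \<le> b" "a' \<le> b'" "b \<le> c" "b' \<le> c'"
    and s: "even s" "s \<le> a + a'" "c + c' \<le> s + 2"
  shows "even b \<or> even b'"
proof (rule ccontr)
  assume odd: "\<not> (even b \<or> even b')"
  then have "even (b + b')" by simp
  moreover have "s \<le> b + b'" "b + b' \<le> s + 2" using assms by linarith+
  ultimately have "b + b' = s \<or> b + b' = s + 2" using s(1) by presburger
  then have "a = b \<and> a' = b' \<or> c = b \<and> c' = b'" using assms by linarith
  then show False using odd assms(1,2) by blast
qed

lemma order_convex_lower: "order_convex (lower_staircase n)"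
proof -
  have "(b, b') \<in> lower_staircase n"
    if ac: "(a, a') \<in> lower_staircase n" "(c, c') \<in> lower_staircase n" and le: "a \<le> b" "a' \<le> b'" "b \<le> c" "b' \<le> c'"
    for a a' b b' c c'
  proof (cases "0 \<le> a \<and> c' \<le> 0")
    case True
    have "even a \<or> even a'" "even c \<or> even c'" "- 2 \<le> a + a'" "c + c' \<le> - 2 + 2"
      using ac True unfolding in_lower by auto
    then have "even b \<or> even b'" using parity_between[of a a' c c' b b' "- 2"] le by simp
    then show ?thesis using ac le True unfolding in_lower by auto
  next
    case False
    \<comment> \<open>The remaining intervals involve the added points. Those starting in column -1
      stay in the filled square; those ending at \<open>(0, 1)\<close> with \<open>0 \<le> a\<close>
      stay in column 0.\<close>
    then have "a = - 1 \<or> 0 \<le> a \<and> c' = 1" using ac unfolding in_lower by linarith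
    then show ?thesis
    proof (elim disjE conjE)
      assume a: "a = - 1"
      then have "0 \<le> a'" using ac(1) unfolding in_lower by linarith
      then have "c \<le> 0" "c' \<le> 1" using ac(2) le unfolding in_lower by linarith+
      then have "b = - 1 \<or> b = 0" "b' = 0 \<or> b' = 1" using a \<open>0 \<le> a'\<close> le by linarith+
      then show ?thesis unfolding in_lower by (elim disjE) simp_all
    next
      assume a: "0 \<le> a" "c' = 1"
      then have "c \<le> 0" using ac(2) unfolding in_lower by linarith
      then have "a = 0" "b = 0" using a le by linarith+
      moreover have "- 2 \<le> b' \<and> - 2 * int n - 1 \<le> b'" "b' \<le> 0 \<or> b' = 1"
        using ac(1) le \<open>a = 0\<close> a(2) unfolding in_lower by linarith+
      ultimately show ?thesis unfolding in_lower by (elim disjE) simp_all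
    qed
  qed
  note between = this
  show ?thesis
    unfolding order_convex_def
  proof (intro ballI allI impI)
    fix x z y assume "x \<in> lower_staircase n" "z \<in> lower_staircase n" "x \<le> y" "y \<le> z"
    then show "y \<in> lower_staircase n"
      using between[of "fst x" "snd x" "fst z" "snd z" "fst y" "snd y"] by (simp add: less_eq_prod_def)
  qed
qed

lemma order_convex_upper: "order_convex (upper_staircase n)"
proof -
  have "(b, b') \<in> upper_staircase n"
    if ac: "(a, a') \<in> upper_staircase n" "(c, c') \<in> upper_staircase n" and le: "a \<le> b" "a' \<le> b'" "b \<le> c" "b' \<le> c'"
    for a a' b b' c c'
  proof (cases "0 \<le> a")
    case True
    have "even a \<or> even a'" "even c \<or> even c'" "0 \<le> a + a'" "c + c' \<le> 0 + 2"
      using ac le True unfolding in_upper by auto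
    then have "even b \<or> even b'" using parity_between[of a a' c c' b b' 0] le by simp
    then show ?thesis using ac le True unfolding in_upper by auto
  next
    case False
    \<comment> \<open>The interval starts at \<open>(-1, 0)\<close>, so it stays in row 0.\<close>
    then have a: "a = - 1" "a' = 0" and c: "c' \<le> 0" "c' = 0 \<longrightarrow> c \<le> 2" "c \<le> 2 * int n + 1"
      using ac unfolding in_upper by auto
    have b': "b' = 0" using a c(1) le by linarith
    then have "b = - 1 \<or> 0 \<le> b \<and> b \<le> 2 \<and> b \<le> 2 * int n + 1" using a c le by linarith
    then show ?thesis unfolding in_upper b' by auto
  qed
  note between = this
  show ?thesis
    unfolding order_convex_def
  proof (intro ballI allI impI)
    fix x z y assume "x \<in> upper_staircase n" "z \<in> upper_staircase n" "x \<le> y" "y \<le> z"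
    then show "y \<in> upper_staircase n"
      using between[of "fst x" "snd x" "fst z" "snd z" "fst y" "snd y"] by (simp add: less_eq_prod_def)
  qed
qed

text \<open>Every staircase point lies below a corner, and \<open>(2j, -2j - 2)\<close> lies below
  the two consecutive corners next to it. The added points reach \<open>(0, 0)\<close> through
  \<open>(0, 1)\<close>.\<close>

lemma zigzag_connected_lower: "zigzag_connected (lower_staircase n - {(- 1, 0)})"
proof (rule zigzag_connectedI)
  let ?R = "comparability (lower_staircase n - {(- 1, 0)})"
  have step: "(p, q) \<in> ?R" if "p \<in> lower_staircase n - {(- 1, 0)}" "q \<in> lower_staircase n - {(- 1, 0)}" "p \<le> q \<or> q \<le> p" for p q
    using that by (auto simp: comparability_def)
  have corner: "((2 * int j, - 2 * int j), (0, 0)) \<in> ?R\<^sup>*" if "j \<le> n" for j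
    using that
  proof (induction j)
    case (Suc j)
    have "((2 * int (Suc j), - 2 * int (Suc j)), (2 * int j, - 2 * int (Suc j))) \<in> ?R"
      "((2 * int j, - 2 * int (Suc j)), (2 * int j, - 2 * int j)) \<in> ?R"
      using Suc.prems by (auto intro!: step simp: in_lower)
    with Suc show ?case by (meson Suc_leD converse_rtrancl_into_rtrancl)
  qed simp
  have corner': "((2 * i, - 2 * i), (0, 0)) \<in> ?R\<^sup>*" if "0 \<le> i" "i \<le> int n" for i
    using corner[of "nat i"] that by simp
  fix p assume p: "p \<in> lower_staircase n - {(- 1, 0)}"
  obtain x y where xy: "p = (x, y)" by fastforce
  have "x = - 1 \<and> y = 1 \<or> (\<exists>i. 0 \<le> i \<and> i \<le> int n \<and> x \<le> 2 * i \<and> y \<le> - 2 * i) \<or> x = 0 \<and> y = 1"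
    using p unfolding xy by (simp add: in_lower) presburger
  then consider "(x, y) = (- 1, 1)" | "(x, y) = (0, 1)" | i where "0 \<le> i" "i \<le> int n" "x \<le> 2 * i" "y \<le> - 2 * i"
    by auto
  then show "(p, (0, 0)) \<in> ?R\<^sup>*"
  proof cases
    case 1
    have "((- 1, 1), (0, 1)) \<in> ?R" "((0, 1), (0, 0)) \<in> ?R"
      by (auto intro!: step simp: in_lower)
    then show ?thesis unfolding xy 1 by (meson converse_rtrancl_into_rtrancl rtrancl.rtrancl_refl)
  next
    case 2
    have "((0, 1), (0, 0)) \<in> ?R" by (auto intro!: step simp: in_lower)
    then show ?thesis unfolding xy 2 by blast
  next
    case (3 i)
    have "(p, (2 * i, - 2 * i)) \<in> ?R"
    proof (rule step)
      show "(2 * i, - 2 * i) \<in> lower_staircase n - {(- 1, 0)}" using 3 by (simp add: in_lower)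
      show "p \<le> (2 * i, - 2 * i) \<or> (2 * i, - 2 * i) \<le> p" using 3 by (simp add: xy)
    qed (rule p)
    then show ?thesis using corner'[OF 3(1,2)] by (rule converse_rtrancl_into_rtrancl)
  qed
qed

text \<open>Here every point lies above a corner, and \<open>(2j + 2, -2j)\<close> lies above two
  consecutive corners.\<close>

lemma zigzag_connected_upper: "zigzag_connected (upper_staircase n - {(- 1, 0)})"
proof (rule zigzag_connectedI)
  let ?R = "comparability (upper_staircase n - {(- 1, 0)})"
  have step: "(p, q) \<in> ?R" if "p \<in> upper_staircase n - {(- 1, 0)}" "q \<in> upper_staircase n - {(- 1, 0)}" "p \<le> q \<or> q \<le> p" for p q
    using that by (auto simp: comparability_def)
  have corner: "((2 * int j, - 2 * int j), (0, 0)) \<in> ?R\<^sup>*" if "j \<le> n" for j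
    using that
  proof (induction j)
    case (Suc j)
    have "((2 * int (Suc j), - 2 * int (Suc j)), (2 * int (Suc j), - 2 * int j)) \<in> ?R"
      "((2 * int (Suc j), - 2 * int j), (2 * int j, - 2 * int j)) \<in> ?R"
      using Suc.prems by (auto intro!: step simp: in_upper)
    with Suc show ?case by (meson Suc_leD converse_rtrancl_into_rtrancl)
  qed simp
  have corner': "((2 * i, - 2 * i), (0, 0)) \<in> ?R\<^sup>*" if "0 \<le> i" "i \<le> int n" for i
    using corner[of "nat i"] that by simp
  fix p assume p: "p \<in> upper_staircase n - {(- 1, 0)}"
  obtain x y where xy: "p = (x, y)" by fastforce
  have "\<exists>i. 0 \<le> i \<and> i \<le> int n \<and> 2 * i \<le> x \<and> - 2 * i \<le> y"
    using p unfolding xy by (simp add: in_upper) presburger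
  then obtain i where i: "0 \<le> i" "i \<le> int n" "2 * i \<le> x" "- 2 * i \<le> y" by blast
  have "(p, (2 * i, - 2 * i)) \<in> ?R"
  proof (rule step)
    show "(2 * i, - 2 * i) \<in> upper_staircase n - {(- 1, 0)}" using i by (simp add: in_upper)
    show "p \<le> (2 * i, - 2 * i) \<or> (2 * i, - 2 * i) \<le> p" using i by (simp add: xy)
  qed (rule p)
  then show "(p, (0, 0)) \<in> ?R\<^sup>*" using corner'[OF i(1,2)] by (rule converse_rtrancl_into_rtrancl)
qed

text \<open>Apart from \<open>(-1, 0)\<close> the common points are the corners; the point directly
  below a corner is on the lower staircase only.\<close>

lemma lower_Int_upper_below:
  assumes "p \<in> lower_staircase n \<inter> upper_staircase n" "p \<noteq> (- 1, 0)"
  shows "\<exists>q\<in>lower_staircase n - upper_staircase n. q \<le> p"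
proof -
  obtain x y where xy: "p = (x, y)" by fastforce
  have "even x \<and> y = - x \<and> 0 \<le> x \<and> x \<le> 2 * int n + 1"
    using assms unfolding xy by (simp add: in_lower in_upper) presburger
  then have "(x, y - 1) \<in> lower_staircase n - upper_staircase n" by (simp add: in_lower in_upper) presburger
  then show ?thesis unfolding xy by (rule bexI[rotated]) simp
qed

section \<open>Counting the holes and assembling the module\<close>

text \<open>The functional for ring \<open>j\<close> reads the edge just below the corner
  \<open>(2j, -2j)\<close>. This edge is on no other ring and not on the filled square. The sign is
  negative because a counterclockwise ring runs down its left side.\<close>

lemma has_holes_ring_chain: "has_holes TYPE('k::field) (ring_chain n) n"
  unfolding has_holes_def
proof (rule quotient_has_dim_dual[where c = ring_cycle and
    \<phi> = "\<lambda>j f. - Poly_Mapping.lookup f ((2 * int j, - 2 * int j - 1), (2 * int j, - 2 * int j))"])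
  have edge: "Poly_Mapping.lookup (bdry2 g) ((2 * int j, - 2 * int j - 1), (2 * int j, - 2 * int j)) =
      Poly_Mapping.lookup g (2 * int j - 1, - 2 * int j - 1) - Poly_Mapping.lookup g (2 * int j, - 2 * int j - 1)"
    for g :: "int \<times> int \<Rightarrow>\<^sub>0 'k" and j
    using lookup_bdry2_vertical[of g "2 * int j" "- 2 * int j - 1"] by simp
  show "free.subspace (cycles1 (ring_chain n) :: (_ \<Rightarrow>\<^sub>0 'k) set)" by (rule subspace_cycles1)
  show "ring_cycle i \<in> (cycles1 (ring_chain n) :: (_ \<Rightarrow>\<^sub>0 'k) set)" if "i < n" for i
    using that by (rule ring_cycle_in_cycles1)
  show "- Poly_Mapping.lookup (ring_cycle i :: _ \<Rightarrow>\<^sub>0 'k)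
      ((2 * int j, - 2 * int j - 1), (2 * int j, - 2 * int j)) = of_bool (i = j)" for i j
  proof -
    have "(2 * int j - 1, - 2 * int j - 1) \<notin> ring_block i" by (simp add: ring_block_def) presburger
    moreover have "(2 * int j, - 2 * int j - 1) \<in> ring_block i \<longleftrightarrow> i = j"
      by (simp add: ring_block_def) presburger
    ultimately show ?thesis unfolding ring_cycle_def edge lookup_ring_block by simp
  qed
  fix f :: "(int \<times> int) \<times> (int \<times> int) \<Rightarrow>\<^sub>0 'k"
  show "- Poly_Mapping.lookup f ((2 * int j, - 2 * int j - 1), (2 * int j, - 2 * int j)) = 0"
    if f: "f \<in> boundaries1 (ring_chain n)" for j
  proof -
    obtain g where g: "Poly_Mapping.keys g \<subseteq> {(- 1, 0)}" "f = bdry2 g"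
      using f by (auto simp: boundaries1_def squares_ring_chain)
    have "(2 * int j - 1, - 2 * int j - 1) \<notin> Poly_Mapping.keys g"
      "(2 * int j, - 2 * int j - 1) \<notin> Poly_Mapping.keys g"
      using g(1) by auto
    then show ?thesis unfolding g(2) edge by (simp add: in_keys_iff)
  qed
  assume f: "f \<in> cycles1 (ring_chain n)"
    and zero: "\<And>j. j < n \<Longrightarrow> - Poly_Mapping.lookup f ((2 * int j, - 2 * int j - 1), (2 * int j, - 2 * int j)) = 0"
  \<comment> \<open>The multiple of the filled square whose boundary agrees with \<open>f\<close> on
    the left side of that square. Subtracting it leaves a cycle that vanishes on all removed
    edges.\<close>
  define g where "g = Poly_Mapping.single (- 1 :: int, 0 :: int) (- Poly_Mapping.lookup f ((- 1, 0), (- 1, 1)))"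
  have b: "bdry2 g \<in> boundaries1 (ring_chain n)"
    unfolding boundaries1_def squares_ring_chain g_def by (auto split: if_splits)
  then have "f - bdry2 g \<in> cycles1 (ring_chain n)"
    using free.subspace_diff[OF subspace_cycles1 f] boundaries1_subset_cycles1 by blast
  then have "f - bdry2 g = 0"
  proof (rule ring_chain_cycle_eq_0)
    show "Poly_Mapping.lookup (f - bdry2 g) ((- 1, 0), (- 1, 1)) = 0"
      using lookup_bdry2_vertical[of g "- 1" 0] by (simp add: lookup_minus g_def lookup_single)
    show "Poly_Mapping.lookup (f - bdry2 g) ((2 * int i, - 2 * int i - 1), (2 * int i, - 2 * int i)) = 0"
      if "i < n" for i
      unfolding lookup_minus edge using zero[OF that] by (simp add: g_def lookup_single when_def)
  qed
  with b show "f \<in> boundaries1 (ring_chain n)" by simp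
qed (simp_all add: lookup_add)

theorem corollary5p1:
  fixes n :: nat
  shows "\<exists>M :: (nat \<Rightarrow>\<^sub>0 'k::field) pmodule.
    persistence_module free_scale M \<and>
    indecomposable free_scale M \<and>
    finite (supp M) \<and>
    has_holes TYPE('k) (supp M) n"
proof (intro exI conjI)
  let ?M = "glued_module (lower_staircase n) (upper_staircase n) (- 1, 0) :: (nat \<Rightarrow>\<^sub>0 'k) pmodule"
  have t: "(- 1, 0) \<in> lower_staircase n" "(- 1, 0) \<in> upper_staircase n" by (simp_all add: in_lower in_upper)
  have supp: "supp ?M = ring_chain n"
    unfolding supp_glued_module[OF t] by (rule lower_Un_upper)
  have "p = (- 1, 0)" if "p \<in> lower_staircase n \<union> upper_staircase n" "p \<le> (- 1, 0)" for p
    using that by (cases p) (auto simp: in_lower in_upper)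
  then show M: "persistence_module free_scale ?M"
    using t order_convex_lower order_convex_upper by (intro persistence_module_glued_module)
  show "indecomposable free_scale ?M"
  proof (rule indecomposable_glued_module[OF M t zigzag_connected_lower zigzag_connected_upper])
    \<comment> \<open>The point \<open>(-1, 1)\<close> sees only the lower staircase;
      \<open>(0, 0)\<close> is the first common corner.\<close>
    show "(- 1, 1) \<in> lower_staircase n - upper_staircase n" "(0, 0) \<in> upper_staircase n - {(- 1, 0)}"
      by (simp_all add: in_lower in_upper)
  qed (simp_all add: lower_Int_upper_below)
  show "finite (supp ?M)" unfolding supp by (rule finite_ring_chain)
  show "has_holes TYPE('k) (supp ?M) n" unfolding supp by (rule has_holes_ring_chain)
qed

end
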